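(* (1) The category $P^{(2)}$ of all spatial partitions on two levels is generated, besides the base partitions $|^{(2)}$ and $\sqcap^{(2)}$, by the partitions $a, c_1, c_2, f_1, f_2, s$; that is, $P^{(2)}=\langle a,c_1,c_2,f_1,f_2,s\rangle$. (2) The category $P_2^{(2)}$ of all spatial pair partitions on two levels (all blocks have exactly two points) is generated, besides the base partitions $|^{(2)}$ and $\sqcap^{(2)}$, by the partitions $a,c_1,c_2,d_1,d_2$; that is, $P_2^{(2)}=\langle a,c_1,c_2,d_1,d_2\rangle$. Here the partitions are: - $a\in P^{(2)}(0,1)$: the single block $\{L_{1,1},L_{1,2}\}$; - $s\in P^{(2)}(0,1)$: the two singleton blocks $\{L_{1,1}\},\{L_{1,2}\}$; - $c_i\in P^{(2)}(2,2)$ ($i=1,2$): on level $i$ the blocks $\{U_{1,i},L_{2,i}\},\{U_{2,i},L_{1,i}\}$, on the other level $j\ne i$ the blocks $\{U_{1,j},L_{1,j}\},\{U_{2,j},L_{2,j}\}$; - $f_i\in P^{(2)}(2,2)$ ($i=1,2$): on level $i$ the single block $\{U_{1,i},U_{2,i},L_{1,i},L_{2,i}\}$, on the other level $j\neq i$ the blocks $\{U_{1,j},L_{1,j}\},\{U_{2,j},L_{2,j}\}$; - $d_i\in P^{(2)}(2,2)$ ($i=1,2$): on level $i$ the blocks $\{U_{1,i},U_{2,i}\},\{L_{1,i},L_{2,i}\}$, on the other level $j\ne i$ the blocks $\{U_{1,j},L_{1,j}\},\{U_{2,j},L_{2,j}\}$.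
   Context: $\mathbb N_0=\{0,1,2,\dots\}$. For $k,l\in\mathbb N_0$, $P^{(2)}(k,l)$ is the set of set partitions (into nonempty blocks) of the set of upper points $U_{x,y}$ ($1\le x\le k$, $y\in\{1,2\}$) and lower points $L_{x,y}$ ($1\le x\le l$, $y\in\{1,2\}$); $x$ is the column (counted from left to right in both rows) and $y$ the level. $P^{(2)}=\bigcup_{k,l}P^{(2)}(k,l)$. Operations: $p\otimes q$ is horizontal juxtaposition ($q$ to the right of $p$); for $q\in P^{(2)}(k,r)$ and $p\in P^{(2)}(r,l)$ the composition $pq\in P^{(2)}(k,l)$ is obtained by identifying the lower points $L_{x,y}$ of $q$ with the upper points $U_{x,y}$ of $p$, joining blocks, and then deleting the middle points (and components consisting only of middle points); $p^*\in P^{(2)}(l,k)$ exchanges upper and lower points. A category of spatial partitions (on two levels) is a subset of $P^{(2)}$ closed under $\otimes$, composition and $^*$ and containing the base partitions $|^{(2)}\in P^{(2)}(1,1)$ (blocks $\{U_{1,y},L_{1,y}\}$, $y=1,2$) and $\sqcap^{(2)}\in P^{(2)}(0,2)$ (blocks $\{L_{1,y},L_{2,y}\}$, $y=1,2$). $\langle p_1,\dots,p_r\rangle$ denotes the smallest category containing $p_1,\dots,p_r$. *)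

theory Defs
  imports "HOL-Library.Disjoint_Sets"
begin

text \<open>
  \<open>Upper x y\<close> and \<open>Lower x y\<close> are the points in column \<open>x\<close> on level \<open>y\<close>, both counted from 1.
  Points \<open>Middle x y\<close> never occur in a spatial partition; they are only used as
  the identified points in the course of a composition.
\<close>

datatype point = Upper nat nat | Middle nat nat | Lower nat nat

type_synonym spatial_partition = "point set set"

definition points :: "nat \<Rightarrow> nat \<Rightarrow> point set" where
  "points k l = {Upper x y | x y. x \<in> {1..k} \<and> y \<in> {1, 2}} \<union> {Lower x y | x y. x \<in> {1..l} \<and> y \<in> {1, 2}}"

text \<open>
  The numbers \<open>k\<close> and \<open>l\<close> are determined by the union of the blocks, so the
  sets \<open>SP k l\<close> are pairwise disjoint and a bare set of blocks suffices to represent a partition.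
\<close>

definition SP :: "nat \<Rightarrow> nat \<Rightarrow> spatial_partition set" where
  "SP k l = {p. partition_on (points k l) p}"

definition spatial_partitions :: "spatial_partition set" where
  "spatial_partitions = (\<Union>k l. SP k l)"

definition spatial_pair_partitions :: "spatial_partition set" where
  "spatial_pair_partitions = {p \<in> spatial_partitions. \<forall>B\<in>p. card B = 2}"

fun shift :: "nat \<Rightarrow> nat \<Rightarrow> point \<Rightarrow> point" where
  "shift k l (Upper x y) = Upper (k + x) y"
| "shift k l (Middle x y) = Middle x y"
| "shift k l (Lower x y) = Lower (l + x) y"

text \<open>\<open>tensor k l p q\<close> is meant for \<open>p \<in> SP k l\<close>.\<close>

definition tensor :: "nat \<Rightarrow> nat \<Rightarrow> spatial_partition \<Rightarrow> spatial_partition \<Rightarrow> spatial_partition" where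
  "tensor k l p q = p \<union> (`) (shift k l) ` q"

fun flip :: "point \<Rightarrow> point" where
  "flip (Upper x y) = Lower x y"
| "flip (Middle x y) = Middle x y"
| "flip (Lower x y) = Upper x y"

definition involution :: "spatial_partition \<Rightarrow> spatial_partition" where
  "involution p = (`) flip ` p"

fun lower_to_middle :: "point \<Rightarrow> point" where
  "lower_to_middle (Lower x y) = Middle x y"
| "lower_to_middle z = z"

fun upper_to_middle :: "point \<Rightarrow> point" where
  "upper_to_middle (Upper x y) = Middle x y"
| "upper_to_middle z = z"

definition stack :: "spatial_partition \<Rightarrow> spatial_partition \<Rightarrow> point set set" where
  "stack p q = (`) lower_to_middle ` q \<union> (`) upper_to_middle ` p"

text \<open>
  Joining all blocks that share a point: the components are the classes of
  the transitive closure of ``lying in a common block'' (which is reflexive on \<open>\<Union>Bs\<close>).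
\<close>

definition join_blocks :: "point set set \<Rightarrow> point set set" where
  "join_blocks Bs = \<Union>Bs // {(u, v). \<exists>B\<in>Bs. u \<in> B \<and> v \<in> B}\<^sup>+"

text \<open>\<open>compose p q\<close> is the product \<open>pq\<close>, meant for \<open>q \<in> SP k r\<close> and \<open>p \<in> SP r l\<close>.\<close>

definition compose :: "spatial_partition \<Rightarrow> spatial_partition \<Rightarrow> spatial_partition" where
  "compose p q = (\<lambda>B. B - {Middle x y | x y. True}) ` join_blocks (stack p q) - {{}}"

definition base_id :: spatial_partition where
  "base_id = {{Upper 1 1, Lower 1 1}, {Upper 1 2, Lower 1 2}}"

definition base_pair :: spatial_partition where
  "base_pair = {{Lower 1 1, Lower 2 1}, {Lower 1 2, Lower 2 2}}"

definition is_category :: "spatial_partition set \<Rightarrow> bool" where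
  "is_category C \<longleftrightarrow>
     C \<subseteq> spatial_partitions \<and> base_id \<in> C \<and> base_pair \<in> C \<and>
     (\<forall>k l p q. p \<in> C \<and> p \<in> SP k l \<and> q \<in> C \<longrightarrow> tensor k l p q \<in> C) \<and>
     (\<forall>k r l p q. q \<in> C \<and> q \<in> SP k r \<and> p \<in> C \<and> p \<in> SP r l \<longrightarrow> compose p q \<in> C) \<and>
     (\<forall>p\<in>C. involution p \<in> C)"

definition generated_category :: "spatial_partition set \<Rightarrow> spatial_partition set" where
  "generated_category S = \<Inter>{C. is_category C \<and> S \<subseteq> C}"

definition part_a :: spatial_partition where
  "part_a = {{Lower 1 1, Lower 1 2}}"

definition part_s :: spatial_partition where
  "part_s = {{Lower 1 1}, {Lower 1 2}}"

text \<open>For \<open>i \<in> {1, 2}\<close>, the other level is \<open>3 - i\<close>.\<close>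

definition through_pairs :: "nat \<Rightarrow> point set set" where
  "through_pairs j = {{Upper 1 j, Lower 1 j}, {Upper 2 j, Lower 2 j}}"

definition part_c :: "nat \<Rightarrow> spatial_partition" where
  "part_c i = {{Upper 1 i, Lower 2 i}, {Upper 2 i, Lower 1 i}} \<union> through_pairs (3 - i)"

definition part_f :: "nat \<Rightarrow> spatial_partition" where
  "part_f i = {{Upper 1 i, Upper 2 i, Lower 1 i, Lower 2 i}} \<union> through_pairs (3 - i)"

definition part_d :: "nat \<Rightarrow> spatial_partition" where
  "part_d i = {{Upper 1 i, Upper 2 i}, {Lower 1 i, Lower 2 i}} \<union> through_pairs (3 - i)"

end

theory Submission
  imports Defs "HOL-Combinatorics.Transposition"
begin

text \<open>
  A partition is determined by the set of Boolean labellings of its points that are constant on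
  blocks. In this semantics composition becomes composition of relations, tensor product becomes
  conjunction and involution becomes conversion, so membership in a category can be derived by
  exhibiting relations instead of joining blocks.

  The partitions \<open>c\<^sub>1\<close>, \<open>c\<^sub>2\<close> give all permutations within a level. Up to these, every pair
  partition of lower points is a tensor product of copies of \<open>a\<close> and of the base pair partition,
  and bending columns to the top gives all pair partitions.
  For arbitrary partitions one starts with the singletons given by \<open>s\<close> and merges two blocks at a
  time, using \<open>f\<^sub>i\<close> within level \<open>i\<close> and a one-block column across levels.
\<close>

section \<open>Labellings constant on blocks\<close>

text \<open>Quantifying existentially over the labels of the middle row settles both clauses of
  composition at once: joined blocks are forced to a common label, and a component of middle points
  only can always be labelled, so it leaves no trace. The relation does not display block sizes,
  however; that a product of pair partitions is again a pair partition therefore needs an argument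
  on blocks. In the generation argument the obstacle is that crossings never move a point to the
  other level. Every block that meets both levels has to come from \<open>a\<close>, so crossings
  must first bring two of its points into one column.\<close>

definition compatible :: "'a set set \<Rightarrow> ('a \<Rightarrow> bool) \<Rightarrow> bool" where
  "compatible P f \<longleftrightarrow> (\<forall>B\<in>P. \<forall>z\<in>B. \<forall>z'\<in>B. f z = f z')"

text \<open>The middle row serves stacked diagrams; \<open>sem\<close> fills it with a default
  label.\<close>

fun lab :: "(nat \<times> nat \<Rightarrow> bool) \<Rightarrow> (nat \<times> nat \<Rightarrow> bool) \<Rightarrow> (nat \<times> nat \<Rightarrow> bool) \<Rightarrow> point \<Rightarrow> bool" where
  "lab u m d (Upper x y) = u (x, y)"
| "lab u m d (Middle x y) = m (x, y)"
| "lab u m d (Lower x y) = d (x, y)"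

definition sem :: "spatial_partition \<Rightarrow> (nat \<times> nat \<Rightarrow> bool) \<Rightarrow> (nat \<times> nat \<Rightarrow> bool) \<Rightarrow> bool" where
  "sem p u d \<longleftrightarrow> compatible p (lab u (\<lambda>_. False) d)"

abbreviation grid :: "nat \<Rightarrow> (nat \<times> nat) set" where
  "grid n \<equiv> {1..n} \<times> {1, 2}"

lemma points_simps [simp]:
  "Upper x y \<in> points k l \<longleftrightarrow> (x, y) \<in> grid k"
  "Lower x y \<in> points k l \<longleftrightarrow> (x, y) \<in> grid l"
  "Middle x y \<notin> points k l"
  by (auto simp: points_def)

lemma compatibleI:
  "(\<And>B z z'. B \<in> P \<Longrightarrow> z \<in> B \<Longrightarrow> z' \<in> B \<Longrightarrow> f z = f z') \<Longrightarrow> compatible P f"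
  unfolding compatible_def by (intro ballI)

lemma compatibleD:
  "compatible P f \<Longrightarrow> B \<in> P \<Longrightarrow> z \<in> B \<Longrightarrow> z' \<in> B \<Longrightarrow> f z = f z'"
  unfolding compatible_def by blast

lemma compatible_cong:
  "(\<And>z. z \<in> \<Union>P \<Longrightarrow> f z = g z) \<Longrightarrow> compatible P f = compatible P g"
  unfolding compatible_def by (meson UnionI)

lemma compatible_image: "compatible ((`) g ` P) f \<longleftrightarrow> compatible P (f \<circ> g)"
  by (auto simp: compatible_def)

lemma compatible_Un: "compatible (P \<union> Q) f \<longleftrightarrow> compatible P f \<and> compatible Q f"
  by (auto simp: compatible_def)

lemma partition_on_unique:
  "partition_on A P \<Longrightarrow> B \<in> P \<Longrightarrow> B' \<in> P \<Longrightarrow> z \<in> B \<Longrightarrow> z \<in> B' \<Longrightarrow> B = B'"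
  unfolding partition_on_def disjoint_def by (meson disjoint_iff)

lemma partition_on_obtain_block:
  assumes "partition_on A P" "z \<in> A"
  obtains B where "B \<in> P" "z \<in> B"
  using assms partition_onD1 by blast

text \<open>By disjointness the indicator function of the block of \<open>z\<close> is constant on
  blocks, so a point that no compatible labelling separates from \<open>z\<close> lies in that
  block. This is why two labels suffice. The conjunct \<open>z \<in> A\<close> excludes points
  outside \<open>A\<close>, which no labelling separates from themselves although they lie in no
  block.\<close>

lemma same_block_iff_compatible:
  assumes "partition_on A P"
  shows "(\<exists>B\<in>P. z \<in> B \<and> z' \<in> B) \<longleftrightarrow> z \<in> A \<and> (\<forall>f. compatible P f \<longrightarrow> f z = f z')"
proof
  assume "\<exists>B\<in>P. z \<in> B \<and> z' \<in> B"
  then show "z \<in> A \<and> (\<forall>f. compatible P f \<longrightarrow> f z = f z')"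
    unfolding compatible_def partition_onD1[OF assms] by blast
next
  assume *: "z \<in> A \<and> (\<forall>f. compatible P f \<longrightarrow> f z = f z')"
  then obtain B where B: "B \<in> P" "z \<in> B" using partition_on_obtain_block[OF assms] by metis
  have "compatible P (\<lambda>w. w \<in> B)"
    unfolding compatible_def
  proof (intro ballI)
    fix B' w w' assume "B' \<in> P" "w \<in> B'" "w' \<in> B'"
    then show "(w \<in> B) = (w' \<in> B)"
      using partition_on_unique[OF assms B(1)] by metis
  qed
  with *[THEN conjunct2, THEN spec, of "\<lambda>w. w \<in> B"] B show "\<exists>B\<in>P. z \<in> B \<and> z' \<in> B" by auto
qed

text \<open>Compatible labellings determine the same-block relation, and a partition is the quotient
  of its carrier by that relation.\<close>

lemma partition_eqI:
  assumes P: "partition_on A P" and Q: "partition_on A Q"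
    and eq: "\<And>f. compatible P f = compatible Q f"
  shows "P = Q"
proof -
  have "(\<exists>B\<in>P. x \<in> B \<and> y \<in> B) \<longleftrightarrow> (\<exists>B\<in>Q. x \<in> B \<and> y \<in> B)" for x y
    by (simp only: same_block_iff_compatible[OF P] same_block_iff_compatible[OF Q] eq)
  then have "A // {(x, y). \<exists>B\<in>P. x \<in> B \<and> y \<in> B} = A // {(x, y). \<exists>B\<in>Q. x \<in> B \<and> y \<in> B}"
    by (simp only:)
  then show ?thesis
    unfolding partition_on_eq_quotient[OF P] partition_on_eq_quotient[OF Q] .
qed

lemma compatible_partition_cong:
  "partition_on A P \<Longrightarrow> (\<And>z. z \<in> A \<Longrightarrow> f z = g z) \<Longrightarrow> compatible P f = compatible P g"
  using compatible_cong[of P f g] by (simp add: partition_on_def)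

lemma SP_partition: "p \<in> SP k l \<longleftrightarrow> partition_on (points k l) p"
  by (simp add: SP_def)

lemma sem_cong:
  assumes "p \<in> SP k l" "\<And>z. z \<in> grid k \<Longrightarrow> u z = u' z" "\<And>z. z \<in> grid l \<Longrightarrow> d z = d' z"
  shows "sem p u d = sem p u' d'"
  unfolding sem_def
proof (rule compatible_partition_cong)
  show "partition_on (points k l) p" using assms(1) by (simp add: SP_partition)
  show "lab u (\<lambda>_. False) d z = lab u' (\<lambda>_. False) d' z" if "z \<in> points k l" for z
    using that assms(2,3) by (cases z) auto
qed

text \<open>On \<open>points k l\<close> every labelling coincides with some
  \<open>lab u (\<lambda>_. False) d\<close>, so \<open>sem\<close> sees all of them.\<close>

lemma SP_eqI:
  assumes p: "p \<in> SP k l" and q: "q \<in> SP k l" and eq: "sem p = sem q"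
  shows "p = q"
proof (rule partition_eqI)
  show "partition_on (points k l) p" "partition_on (points k l) q" using p q by (auto simp: SP_partition)
  fix f
  have *: "compatible r f = sem r (\<lambda>(x, y). f (Upper x y)) (\<lambda>(x, y). f (Lower x y))" if "r \<in> SP k l" for r
    unfolding sem_def
  proof (rule compatible_partition_cong)
    show "partition_on (points k l) r" using that by (simp add: SP_partition)
    show "f z = lab (\<lambda>(x, y). f (Upper x y)) (\<lambda>_. False) (\<lambda>(x, y). f (Lower x y)) z" if "z \<in> points k l" for z
      using that by (cases z) auto
  qed
  show "compatible p f = compatible q f" unfolding *[OF p] *[OF q] eq ..
qed

section \<open>Tensor product, involution and composition as operations on relations\<close>

lemma partition_on_image:
  assumes "partition_on A P" "inj_on f A"
  shows "partition_on (f ` A) ((`) f ` P)"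
proof -
  have "(`) f ` P - {{}} = (`) f ` P" using assms(1) by (auto simp: partition_on_def)
  then show ?thesis using partition_on_inj_image[OF assms] by simp
qed

lemma partition_on_disjoint_Un:
  assumes P: "partition_on A P" and Q: "partition_on B Q" and AB: "A \<inter> B = {}"
  shows "partition_on (A \<union> B) (P \<union> Q)"
proof (rule partition_onI)
  show "\<Union>(P \<union> Q) = A \<union> B" "{} \<notin> P \<union> Q" using P Q by (auto simp: partition_on_def)
  have PQ: "disjnt X Y" if "X \<in> P" "Y \<in> Q" for X Y
    using that AB unfolding partition_onD1[OF P] partition_onD1[OF Q] disjnt_def by blast
  fix X Y assume "X \<in> P \<union> Q" "Y \<in> P \<union> Q" "X \<noteq> Y"
  then consider "X \<in> P" "Y \<in> P" | "X \<in> P" "Y \<in> Q" | "Y \<in> P" "X \<in> Q" | "X \<in> Q" "Y \<in> Q"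
    by blast
  then show "disjnt X Y"
  proof cases
    case 1
    then show ?thesis using pairwiseD[OF partition_onD2[OF P]] \<open>X \<noteq> Y\<close> by simp
  next
    case 2
    then show ?thesis by (rule PQ)
  next
    case 3
    then show ?thesis by (rule PQ[THEN disjnt_sym])
  next
    case 4
    then show ?thesis using pairwiseD[OF partition_onD2[OF Q]] \<open>X \<noteq> Y\<close> by simp
  qed
qed

lemma inj_shift: "inj (shift k l)"
proof (rule injI)
  fix z z' show "shift k l z = shift k l z' \<Longrightarrow> z = z'" by (cases z; cases z') auto
qed

lemma inj_flip: "inj flip"
proof (rule injI)
  fix z z' show "flip z = flip z' \<Longrightarrow> z = z'" by (cases z; cases z') auto
qed

lemma points_add: "points (k + k') (l + l') = points k l \<union> shift k l ` points k' l'" (is "_ = ?R")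
proof (intro equalityI subsetI)
  fix z assume z: "z \<in> points (k + k') (l + l')"
  show "z \<in> ?R"
  proof (cases z)
    case (Upper x y)
    then have "x \<le> k \<or> z = shift k l (Upper (x - k) y)" by auto
    with z Upper show ?thesis by (force intro: image_eqI[of _ _ "Upper (x - k) y"])
  next
    case (Lower x y)
    then have "x \<le> l \<or> z = shift k l (Lower (x - l) y)" by auto
    with z Lower show ?thesis by (force intro: image_eqI[of _ _ "Lower (x - l) y"])
  qed (use z in auto)
qed (auto simp: points_def)

lemma points_shift_disjoint: "points k l \<inter> shift k l ` points k' l' = {}"
  by (auto simp: points_def)

lemma tensor_SP:
  assumes "p \<in> SP k l" "q \<in> SP k' l'"
  shows "tensor k l p q \<in> SP (k + k') (l + l')"
  using assms unfolding SP_partition tensor_def points_add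
  by (intro partition_on_disjoint_Un partition_on_image points_shift_disjoint inj_on_subset[OF inj_shift]) auto

lemma sem_tensor:
  "sem (tensor k l p q) u d \<longleftrightarrow>
     sem p u d \<and> sem q (\<lambda>(x, y). u (k + x, y)) (\<lambda>(x, y). d (l + x, y))"
proof -
  have "lab u (\<lambda>_. False) d \<circ> shift k l =
      lab (\<lambda>(x, y). u (k + x, y)) (\<lambda>_. False) (\<lambda>(x, y). d (l + x, y))" (is "?f = ?g")
  proof
    fix z show "?f z = ?g z" by (cases z) auto
  qed
  then show ?thesis by (simp add: sem_def tensor_def compatible_Un compatible_image)
qed

lemma flip_points: "flip ` points k l = points l k"
proof -
  have *: "flip ` points k l \<subseteq> points l k" for k l by (auto simp: points_def)
  have "flip (flip z) = z" for z by (cases z) auto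
  then show ?thesis using *[of k l] image_mono[OF *[of l k], of flip] by (simp add: image_image)
qed

lemma involution_SP: "p \<in> SP k l \<Longrightarrow> involution p \<in> SP l k"
  unfolding SP_partition involution_def flip_points[of k l, symmetric]
  by (intro partition_on_image inj_on_subset[OF inj_flip]) auto

lemma sem_involution: "sem (involution p) u d \<longleftrightarrow> sem p d u"
proof -
  have "lab u (\<lambda>_. False) d \<circ> flip = lab d (\<lambda>_. False) u" (is "?f = ?g")
  proof
    fix z show "?f z = ?g z" by (cases z) auto
  qed
  then show ?thesis by (simp add: sem_def involution_def compatible_image)
qed

lemma equiv_joined: "equiv (\<Union>Bs) ({(u, v). \<exists>B\<in>Bs. u \<in> B \<and> v \<in> B}\<^sup>+)"
proof (rule equivI)
  let ?R = "{(u, v). \<exists>B\<in>Bs. u \<in> B \<and> v \<in> B}"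
  show "?R\<^sup>+ \<subseteq> \<Union>Bs \<times> \<Union>Bs" by (rule trancl_subset_Sigma) auto
  show "refl_on (\<Union>Bs) (?R\<^sup>+)" by (auto intro!: refl_onI r_into_trancl)
  show "sym (?R\<^sup>+)" by (intro sym_trancl symI) auto
  show "trans (?R\<^sup>+)" by (rule trans_trancl)
qed

lemma partition_on_join_blocks: "partition_on (\<Union>Bs) (join_blocks Bs)"
  unfolding join_blocks_def by (intro partition_on_quotient equiv_joined)

text \<open>Equality of labels propagates along chains of overlapping blocks, so passing to the
  transitive closure imposes no further condition.\<close>

lemma compatible_join_blocks: "compatible (join_blocks Bs) f \<longleftrightarrow> compatible Bs f"
proof
  assume *: "compatible (join_blocks Bs) f"
  show "compatible Bs f" unfolding compatible_def
  proof (intro ballI)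
    fix B z z' assume B: "B \<in> Bs" "z \<in> B" "z' \<in> B"
    let ?R = "{(u, v). \<exists>B\<in>Bs. u \<in> B \<and> v \<in> B}\<^sup>+"
    have "?R `` {z} \<in> join_blocks Bs" unfolding join_blocks_def using B by (intro quotientI) auto
    moreover have "z \<in> ?R `` {z}" "z' \<in> ?R `` {z}" using B by (auto intro!: r_into_trancl)
    ultimately show "f z = f z'" using * unfolding compatible_def by blast
  qed
next
  assume *: "compatible Bs f"
  have "f z = f z'" if "(z, z') \<in> {(u, v). \<exists>B\<in>Bs. u \<in> B \<and> v \<in> B}\<^sup>+" for z z'
    using that by (induction rule: trancl_induct) (use * in \<open>auto simp: compatible_def\<close>)
  then show "compatible (join_blocks Bs) f"
    unfolding compatible_def join_blocks_def quotient_def by auto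
qed

text \<open>Deleting points is projection: a labelling of the surviving points is constant on the
  truncated blocks exactly when it extends to the deleted ones.\<close>

lemma compatible_delete:
  assumes "partition_on A P"
  shows "compatible ((\<lambda>B. B - M) ` P - {{}}) f \<longleftrightarrow> (\<exists>g. (\<forall>z\<in>A - M. g z = f z) \<and> compatible P g)"
proof
  assume f: "compatible ((\<lambda>B. B - M) ` P - {{}}) f"
  \<comment> \<open>A deleted point inherits the label that the survivors of its block share; a
    block without survivors is labelled \<open>False\<close>.\<close>
  define g where "g z \<longleftrightarrow> (\<exists>B\<in>P. z \<in> B \<and> (\<exists>w\<in>B - M. f w))" for z
  have g_iff: "g z \<longleftrightarrow> (\<exists>w\<in>B - M. f w)" if "B \<in> P" "z \<in> B" for B z
  proof
    assume "g z"
    then obtain B' w where B': "B' \<in> P" "z \<in> B'" "w \<in> B' - M" "f w" unfolding g_def by blast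
    then have "B' = B" using partition_on_unique[OF assms B'(1) that(1) B'(2) that(2)] by simp
    with B' show "\<exists>w\<in>B - M. f w" by blast
  qed (use that in \<open>auto simp: g_def\<close>)
  have "compatible P g"
    by (rule compatibleI) (simp add: g_iff)
  moreover have "g z = f z" if z: "z \<in> A - M" for z
  proof -
    obtain B where B: "B \<in> P" "z \<in> B" using z partition_on_obtain_block[OF assms] by blast
    have "f w = f z" if "w \<in> B - M" for w
      by (rule compatibleD[OF f, of "B - M"]) (use that B z in auto)
    then show ?thesis using g_iff[OF B] B z by (metis DiffD2 DiffI)
  qed
  ultimately show "\<exists>g. (\<forall>z\<in>A - M. g z = f z) \<and> compatible P g" by blast
next
  assume "\<exists>g. (\<forall>z\<in>A - M. g z = f z) \<and> compatible P g"
  then obtain g where g: "\<forall>z\<in>A - M. g z = f z" "compatible P g" by blast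
  show "compatible ((\<lambda>B. B - M) ` P - {{}}) f"
  proof (rule compatibleI)
    fix B z z' assume "B \<in> (\<lambda>B. B - M) ` P - {{}}" and z: "z \<in> B" "z' \<in> B"
    then obtain B' where B': "B' \<in> P" "B = B' - M" by blast
    then have "z \<in> A - M" "z' \<in> A - M" using z partition_onD1[OF assms] by auto
    moreover have "g z = g z'" using compatibleD[OF g(2) B'(1)] z B'(2) by blast
    ultimately show "f z = f z'" using g(1) by metis
  qed
qed

lemma Union_stack:
  assumes "q \<in> SP k r" "p \<in> SP r l"
  shows "\<Union>(stack p q) = points k l \<union> {Middle x y | x y. (x, y) \<in> grid r}"
proof -
  have "\<Union>q = points k r" "\<Union>p = points r l"
    using assms by (auto simp: SP_partition partition_on_def)
  then have "\<Union>(stack p q) = lower_to_middle ` points k r \<union> upper_to_middle ` points r l"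
    by (simp only: stack_def Union_Un_distrib image_Union[symmetric])
  also have "\<dots> = points k l \<union> {Middle x y | x y. (x, y) \<in> grid r}"
  proof (intro equalityI subsetI)
    fix z assume "z \<in> points k l \<union> {Middle x y | x y. (x, y) \<in> grid r}"
    then show "z \<in> lower_to_middle ` points k r \<union> upper_to_middle ` points r l"
    proof (cases z)
      case (Upper x y)
      with \<open>z \<in> _\<close> have "z \<in> points k r" "lower_to_middle z = z" by auto
      then show ?thesis by (metis UnI1 imageI)
    next
      case (Middle x y)
      with \<open>z \<in> _\<close> have "Lower x y \<in> points k r" "lower_to_middle (Lower x y) = z" by auto
      then show ?thesis by (metis UnI1 imageI)
    next
      case (Lower x y)
      with \<open>z \<in> _\<close> have "z \<in> points r l" "upper_to_middle z = z" by auto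
      then show ?thesis by (metis UnI2 imageI)
    qed
  qed (auto simp: points_def)
  finally show ?thesis .
qed

lemma compatible_stack:
  assumes "q \<in> SP k r" "p \<in> SP r l"
  shows "compatible (stack p q) (lab u m d) \<longleftrightarrow> sem q u m \<and> sem p m d"
proof -
  have "compatible q (lab u m d \<circ> lower_to_middle) = sem q u m"
    unfolding sem_def
  proof (rule compatible_partition_cong)
    show "partition_on (points k r) q" using assms by (simp add: SP_partition)
    show "(lab u m d \<circ> lower_to_middle) z = lab u (\<lambda>_. False) m z" if "z \<in> points k r" for z
      using that by (cases z) auto
  qed
  moreover have "compatible p (lab u m d \<circ> upper_to_middle) = sem p m d"
    unfolding sem_def
  proof (rule compatible_partition_cong)
    show "partition_on (points r l) p" using assms by (simp add: SP_partition)
    show "(lab u m d \<circ> upper_to_middle) z = lab m (\<lambda>_. False) d z" if "z \<in> points r l" for z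
      using that by (cases z) auto
  qed
  ultimately show ?thesis by (simp add: stack_def compatible_Un compatible_image)
qed

lemma compose_SP:
  assumes "q \<in> SP k r" "p \<in> SP r l"
  shows "compose p q \<in> SP k l"
proof -
  have "points k l = \<Union>(stack p q) - {Middle x y | x y. True}"
    unfolding Union_stack[OF assms] by (auto simp: points_def)
  then show ?thesis
    unfolding SP_partition compose_def
    by (simp only:) (rule partition_on_transform[OF partition_on_join_blocks], auto simp: disjnt_def)
qed

text \<open>Joining blocks keeps the compatible labellings, and deletion turns into a quantifier
  over the deleted labels, here those of the middle row.\<close>

lemma sem_compose:
  assumes "q \<in> SP k r" "p \<in> SP r l"
  shows "sem (compose p q) u d \<longleftrightarrow> (\<exists>m. sem q u m \<and> sem p m d)"
proof -
  let ?A = "\<Union>(stack p q)" and ?M = "{Middle x y | x y. True}"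
  have A: "?A - ?M = points k l"
    unfolding Union_stack[OF assms] by (auto simp: points_def)
  have "sem (compose p q) u d \<longleftrightarrow>
      (\<exists>g. (\<forall>z\<in>points k l. g z = lab u (\<lambda>_. False) d z) \<and> compatible (stack p q) g)"
    unfolding sem_def compose_def compatible_delete[OF partition_on_join_blocks]
      compatible_join_blocks A ..
  also have "\<dots> \<longleftrightarrow> (\<exists>m. compatible (stack p q) (lab u m d))" (is "?L = ?R")
  proof
    assume ?L
    then obtain g where g: "\<forall>z\<in>points k l. g z = lab u (\<lambda>_. False) d z" "compatible (stack p q) g"
      by blast
    have "compatible (stack p q) (lab u (\<lambda>(x, y). g (Middle x y)) d) = compatible (stack p q) g"
    proof (rule compatible_cong)
      fix z assume z: "z \<in> ?A"
      show "lab u (\<lambda>(x, y). g (Middle x y)) d z = g z"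
        using z g(1) unfolding Union_stack[OF assms] by (cases z) auto
    qed
    with g show ?R by blast
  next
    assume ?R
    then obtain m where m: "compatible (stack p q) (lab u m d)" by blast
    have "lab u m d z = lab u (\<lambda>_. False) d z" if "z \<in> points k l" for z
      using that by (cases z) auto
    with m show ?L by blast
  qed
  finally show ?thesis by (simp add: compatible_stack[OF assms])
qed

section \<open>The generators and the category of all spatial partitions\<close>

lemma generators_SP:
  "base_id \<in> SP 1 1" "base_pair \<in> SP 0 2" "part_a \<in> SP 0 1" "part_s \<in> SP 0 1"
  "i \<in> {1, 2} \<Longrightarrow> part_c i \<in> SP 2 2"
  "i \<in> {1, 2} \<Longrightarrow> part_d i \<in> SP 2 2"
  "i \<in> {1, 2} \<Longrightarrow> part_f i \<in> SP 2 2"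
proof -
  have "{1..2::nat} = {1, 2}" by auto
  note defs = SP_partition partition_on_def disjoint_def points_def base_id_def base_pair_def part_a_def part_s_def
    part_c_def part_d_def part_f_def through_pairs_def this
  show "base_id \<in> SP 1 1" "base_pair \<in> SP 0 2" "part_a \<in> SP 0 1" "part_s \<in> SP 0 1"
    unfolding defs by auto
  show "part_c i \<in> SP 2 2" "part_d i \<in> SP 2 2" "part_f i \<in> SP 2 2" if "i \<in> {1, 2}"
    using that unfolding defs by (auto simp: insert_commute)
qed

lemma spatial_partitions_iff: "p \<in> spatial_partitions \<longleftrightarrow> (\<exists>k l. p \<in> SP k l)"
  by (simp add: spatial_partitions_def)

lemma is_category_spatial_partitions: "is_category spatial_partitions"
  unfolding is_category_def
proof (intro conjI allI impI ballI)
  show "base_id \<in> spatial_partitions" "base_pair \<in> spatial_partitions"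
    using generators_SP spatial_partitions_iff by metis+
  fix k l r p q
  show "tensor k l p q \<in> spatial_partitions"
    if "p \<in> spatial_partitions \<and> p \<in> SP k l \<and> q \<in> spatial_partitions"
    using that tensor_SP unfolding spatial_partitions_iff by metis
  show "compose p q \<in> spatial_partitions"
    if "q \<in> spatial_partitions \<and> q \<in> SP k r \<and> p \<in> spatial_partitions \<and> p \<in> SP r l"
    using that compose_SP unfolding spatial_partitions_iff by metis
  show "involution p \<in> spatial_partitions" if "p \<in> spatial_partitions"
    using that involution_SP unfolding spatial_partitions_iff by metis
qed simp

section \<open>The category of pair partitions\<close>

lemma partition_on_Diff_blocks:
  assumes P: "partition_on A P" and "S \<subseteq> P"
  shows "partition_on (A - \<Union>S) (P - S)"
proof (rule partition_onI)
  show "\<Union>(P - S) = A - \<Union>S"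
  proof (intro equalityI subsetI)
    fix z assume "z \<in> \<Union>(P - S)"
    then obtain B where B: "B \<in> P" "B \<notin> S" "z \<in> B" by blast
    then have "z \<notin> \<Union>S" using partition_on_unique[OF P] \<open>S \<subseteq> P\<close> by blast
    with B show "z \<in> A - \<Union>S" using partition_onD1[OF P] by blast
  next
    fix z assume "z \<in> A - \<Union>S"
    then show "z \<in> \<Union>(P - S)" using partition_onD1[OF P] by blast
  qed
  show "{} \<notin> P - S" using partition_onD3[OF P] by simp
  show "disjnt X Y" if "X \<in> P - S" "Y \<in> P - S" "X \<noteq> Y" for X Y
    using that pairwiseD[OF partition_onD2[OF P]] by simp
qed

lemma pair_block_partner:
  assumes P: "partition_on A P" and card2: "\<forall>B\<in>P. card B = 2" and z: "z \<in> A"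
  shows "\<exists>z'. {z, z'} \<in> P \<and> z \<noteq> z' \<and> z' \<in> A"
proof -
  obtain B where B: "B \<in> P" "z \<in> B" using partition_on_obtain_block[OF P z] .
  then obtain u v where uv: "B = {u, v}" "u \<noteq> v" using card2 by (auto simp: card_2_iff)
  have "B \<subseteq> A" using B partition_onD1[OF P] by blast
  then show ?thesis using B uv by (cases "z = u") (auto simp: insert_commute)
qed

text \<open>
  Blocks of size two stay of size two when two points are identified and deleted; since a
  composition is an iteration of this step, no analysis of paths in the stacked diagram is needed.
\<close>

lemma contract_pair:
  assumes P: "partition_on A P" and card2: "\<forall>B\<in>P. card B = 2"
    and ab: "a \<in> A" "b \<in> A" "a \<noteq> b"
  shows "\<exists>Q. partition_on (A - {a, b}) Q \<and> (\<forall>B\<in>Q. card B = 2) \<and>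
    (\<forall>f. compatible Q f \<longleftrightarrow> (\<exists>g. (\<forall>z\<in>A - {a, b}. g z = f z) \<and> g a = g b \<and> compatible P g))"
proof -
  note unique = partition_on_unique[OF P]
  obtain a' where a': "{a, a'} \<in> P" "a \<noteq> a'" "a' \<in> A" using pair_block_partner[OF P card2 ab(1)] by blast
  obtain b' where b': "{b, b'} \<in> P" "b \<noteq> b'" "b' \<in> A" using pair_block_partner[OF P card2 ab(2)] by blast
  show ?thesis
  proof (cases "a' = b")
    case True
    \<comment> \<open>Here \<open>a\<close> and \<open>b\<close> close up to a loop, which
      disappears without affecting the other blocks; any common label serves for it.\<close>
    let ?Q = "P - {{a, b}}"
    have Q: "partition_on (A - {a, b}) ?Q"
      using partition_on_Diff_blocks[OF P, of "{{a, b}}"] a' True by simp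
    have "\<exists>g. (\<forall>z\<in>A - {a, b}. g z = f z) \<and> g a = g b \<and> compatible P g" if f: "compatible ?Q f" for f
    proof (intro exI conjI)
      let ?g = "f(a := True, b := True)"
      show "compatible P ?g"
      proof (rule compatibleI)
        fix B z z' assume B: "B \<in> P" and z: "z \<in> B" "z' \<in> B"
        show "?g z = ?g z'"
        proof (cases "B = {a, b}")
          case False
          then have "B \<in> ?Q" using B by simp
          then have "B \<subseteq> A - {a, b}" using partition_onD1[OF Q] by blast
          then have "?g z = f z" "?g z' = f z'" using z by auto
          then show ?thesis using compatibleD[OF f \<open>B \<in> ?Q\<close> z] by simp
        qed (use z in auto)
      qed
    qed auto
    moreover have "compatible ?Q f"
      if g: "\<forall>z\<in>A - {a, b}. g z = f z" "compatible P g" for f g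
    proof -
      have "compatible ?Q g" by (rule compatibleI, rule compatibleD[OF g(2)]) auto
      then show ?thesis using compatible_partition_cong[OF Q, of g f] g(1) by simp
    qed
    ultimately show ?thesis using card2 Q by (intro exI[of _ ?Q] conjI allI iffI) (simp, simp, blast, blast)
  next
    case False
    have "b' \<noteq> a" using unique[OF a'(1) b'(1), of a] False b' ab by auto
    have "a' \<noteq> b'" using unique[OF a'(1) b'(1), of a'] ab a' b' by auto
    \<comment> \<open>The partners \<open>a'\<close> and \<open>b'\<close> are left over and become
      one block: a label travels from \<open>a'\<close> through the identified points
      \<open>a\<close>, \<open>b\<close> to \<open>b'\<close>.\<close>
    let ?R = "P - {{a, a'}, {b, b'}}" and ?Q = "insert {a', b'} (P - {{a, a'}, {b, b'}})"
    have R: "partition_on (A - {a, a', b, b'}) ?R"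
      using partition_on_Diff_blocks[OF P, of "{{a, a'}, {b, b'}}"] a' b' by (simp add: insert_commute)
    have "partition_on ({a', b'} \<union> (A - {a, a', b, b'})) ({{a', b'}} \<union> ?R)"
      by (intro partition_on_disjoint_Un R partition_on_space) auto
    moreover have "{a', b'} \<union> (A - {a, a', b, b'}) = A - {a, b}"
      using a' b' False \<open>b' \<noteq> a\<close> by auto
    ultimately have Q: "partition_on (A - {a, b}) ?Q" by simp
    have "\<exists>g. (\<forall>z\<in>A - {a, b}. g z = f z) \<and> g a = g b \<and> compatible P g" if f: "compatible ?Q f" for f
    proof (intro exI conjI)
      let ?g = "f(a := f a', b := f a')"
      have eq: "f a' = f b'" by (rule compatibleD[OF f, of "{a', b'}"]) auto
      show "compatible P ?g"
      proof (rule compatibleI)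
        fix B z z' assume B: "B \<in> P" and z: "z \<in> B" "z' \<in> B"
        consider "B = {a, a'}" | "B = {b, b'}" | "B \<in> ?R" using B by blast
        then show "?g z = ?g z'"
        proof cases
          case 3
          then have "B \<subseteq> A - {a, a', b, b'}" using partition_onD1[OF R] by blast
          then have "?g z = f z" "?g z' = f z'" using z by auto
          then show ?thesis using compatibleD[OF f _ z] 3 by simp
        qed (use z eq False \<open>b' \<noteq> a\<close> a' b' in auto)
      qed
    qed auto
    moreover have "compatible ?Q f"
      if g: "\<forall>z\<in>A - {a, b}. g z = f z" "g a = g b" "compatible P g" for f g
    proof -
      have "g a = g a'" by (rule compatibleD[OF g(3) a'(1)]) auto
      moreover have "g b = g b'" by (rule compatibleD[OF g(3) b'(1)]) auto
      ultimately have "g a' = g b'" using g(2) by simp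
      have "compatible ?Q g"
      proof (rule compatibleI)
        fix B z z' assume "B \<in> ?Q" and z: "z \<in> B" "z' \<in> B"
        then consider "B = {a', b'}" | "B \<in> P" by blast
        then show "g z = g z'"
          by cases (use z \<open>g a' = g b'\<close> compatibleD[OF g(3) _ z] in auto)
      qed
      then show ?thesis using compatible_partition_cong[OF Q, of g f] g(1) by simp
    qed
    moreover have "card {a', b'} = 2" using \<open>a' \<noteq> b'\<close> by simp
    ultimately show ?thesis using card2 Q by (intro exI[of _ ?Q] conjI allI iffI) (simp, simp, blast, blast)
  qed
qed

text \<open>Iterates \<open>contract_pair\<close>. Injectivity and disjointness of the images
  guarantee that the two points of the next pair have survived all earlier contractions. Describing
  \<open>Q\<close> by its compatible labellings makes the steps chain together, as extensions of
  extensions.\<close>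

lemma contract_pairs:
  assumes "finite I" and P: "partition_on A P" "\<forall>B\<in>P. card B = 2"
    and "a ` I \<subseteq> A" "b ` I \<subseteq> A" "inj_on a I" "inj_on b I" "a ` I \<inter> b ` I = {}"
  shows "\<exists>Q. partition_on (A - (a ` I \<union> b ` I)) Q \<and> (\<forall>B\<in>Q. card B = 2) \<and>
    (\<forall>f. compatible Q f \<longleftrightarrow>
      (\<exists>g. (\<forall>z\<in>A - (a ` I \<union> b ` I). g z = f z) \<and> (\<forall>i\<in>I. g (a i) = g (b i)) \<and> compatible P g))"
  using assms(1,4-)
proof (induction I rule: finite_induct)
  case empty
  have "compatible P f" if "\<forall>z\<in>A. g z = f z" "compatible P g" for f g
    using compatible_partition_cong[OF P(1), of g f] that by simp
  then have "compatible P f \<longleftrightarrow> (\<exists>g. (\<forall>z\<in>A. g z = f z) \<and> compatible P g)" for f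
    by (intro iffI exI[of _ f] conjI) (simp, assumption, elim exE conjE)
  with P show ?case
    unfolding image_empty Un_empty_left Diff_empty ball_empty simp_thms
    by (intro exI[of _ P] conjI allI)
next
  case (insert j I)
  let ?A = "A - (a ` I \<union> b ` I)"
  have A': "A - (a ` insert j I \<union> b ` insert j I) = ?A - {a j, b j}" by auto
  have "a ` I \<subseteq> A" "b ` I \<subseteq> A" "inj_on a I" "inj_on b I" "a ` I \<inter> b ` I = {}"
    using insert.prems by (auto simp only: insert_subset image_insert inj_on_insert)
  from insert.IH[OF this] obtain Q where "partition_on ?A Q \<and> (\<forall>B\<in>Q. card B = 2) \<and>
    (\<forall>f. compatible Q f \<longleftrightarrow>
      (\<exists>g. (\<forall>z\<in>?A. g z = f z) \<and> (\<forall>i\<in>I. g (a i) = g (b i)) \<and> compatible P g))"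
    by (rule exE)
  then have Q: "partition_on ?A Q" "\<forall>B\<in>Q. card B = 2"
    and compat_Q: "\<forall>f. compatible Q f \<longleftrightarrow>
      (\<exists>g. (\<forall>z\<in>?A. g z = f z) \<and> (\<forall>i\<in>I. g (a i) = g (b i)) \<and> compatible P g)"
    by - (elim conjE, assumption)+
  have "a j \<notin> a ` I" "b j \<notin> b ` I" using insert.prems(3,4) insert.hyps(2) by (simp_all add: inj_on_insert)
  then have j: "a j \<in> ?A" "b j \<in> ?A" "a j \<noteq> b j" using insert.prems(1,2,5) by auto
  from contract_pair[OF Q this] obtain Q' where "partition_on (?A - {a j, b j}) Q' \<and>
    (\<forall>B\<in>Q'. card B = 2) \<and> (\<forall>f. compatible Q' f \<longleftrightarrow>
      (\<exists>g. (\<forall>z\<in>?A - {a j, b j}. g z = f z) \<and> g (a j) = g (b j) \<and> compatible Q g))"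
    by (rule exE)
  then have Q': "partition_on (?A - {a j, b j}) Q'" "\<forall>B\<in>Q'. card B = 2"
    and compat_Q': "\<forall>f. compatible Q' f \<longleftrightarrow>
      (\<exists>g. (\<forall>z\<in>?A - {a j, b j}. g z = f z) \<and> g (a j) = g (b j) \<and> compatible Q g)"
    by - (elim conjE, assumption)+
  have "\<exists>h. (\<forall>z\<in>?A - {a j, b j}. h z = f z) \<and> (\<forall>i\<in>insert j I. h (a i) = h (b i)) \<and> compatible P h"
    if f: "compatible Q' f" for f
  proof -
    obtain g where g: "\<forall>z\<in>?A - {a j, b j}. g z = f z" "g (a j) = g (b j)" "compatible Q g"
      using f[unfolded compat_Q'[rule_format]] by (elim exE conjE)
    obtain h where h: "\<forall>z\<in>?A. h z = g z" "\<forall>i\<in>I. h (a i) = h (b i)" "compatible P h"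
      using g(3)[unfolded compat_Q[rule_format]] by (elim exE conjE)
    \<comment> \<open>Since \<open>a j\<close> and \<open>b j\<close> still lie in
      \<open>?A\<close>, \<open>h\<close> agrees with \<open>g\<close> there, and the equation for
      \<open>j\<close> passes from \<open>g\<close> to \<open>h\<close>.\<close>
    show ?thesis using g(1,2) h j by (intro exI[of _ h]) simp
  qed
  moreover have "compatible Q' f"
    if h: "\<forall>z\<in>?A - {a j, b j}. h z = f z" "\<forall>i\<in>insert j I. h (a i) = h (b i)" "compatible P h" for f h
  proof -
    have "compatible Q h" unfolding compat_Q[rule_format] using h(2,3) by (intro exI[of _ h]) simp
    then show ?thesis unfolding compat_Q'[rule_format] using h(1,2) by (intro exI[of _ h]) simp
  qed
  ultimately show ?case unfolding A' using Q'
    by (intro exI[of _ Q'] conjI allI iffI) (assumption, assumption, blast, blast)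
qed

text \<open>
  Before contraction the two copies of a middle point must be kept apart; the copy coming from the
  second partition is moved to the unused levels 3 and 4.
\<close>

fun upper_to_high_middle :: "point \<Rightarrow> point" where
  "upper_to_high_middle (Upper x y) = Middle x (y + 2)"
| "upper_to_high_middle z = z"

text \<open>Contraction yields some pair partition \<open>Q\<close>, not visibly the product. Its
  relation is the relational product, so \<open>SP_eqI\<close> identifies it with
  \<open>compose p q\<close>, which thereby inherits the block size.\<close>

lemma compose_pairs:
  assumes q: "q \<in> SP k r" and p: "p \<in> SP r l"
    and card_q: "\<forall>B\<in>q. card B = 2" and card_p: "\<forall>B\<in>p. card B = 2"
  shows "\<forall>B\<in>compose p q. card B = 2"
proof -
  let ?e = lower_to_middle and ?e' = upper_to_high_middle
  let ?a = "\<lambda>(x, y). Middle x y" and ?b = "\<lambda>(x, y). Middle x (y + 2)"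
  let ?A = "?e ` points k r \<union> ?e' ` points r l" and ?P = "(`) ?e ` q \<union> (`) ?e' ` p"
  have q': "partition_on (points k r) q" and p': "partition_on (points r l) p"
    using q p by (simp_all add: SP_partition)
  have inj_e: "inj_on ?e (points k r)"
  proof (rule inj_onI)
    show "z = z'" if "z \<in> points k r" "z' \<in> points k r" "?e z = ?e z'" for z z'
      using that by (cases z; cases z') auto
  qed
  have inj_e': "inj_on ?e' (points r l)"
  proof (rule inj_onI)
    show "z = z'" if "z \<in> points r l" "z' \<in> points r l" "?e' z = ?e' z'" for z z'
      using that by (cases z; cases z') auto
  qed
  have "?e ` points k r \<inter> ?e' ` points r l = {}"
    by (auto simp: points_def)
  then have P: "partition_on ?A ?P"
    by (intro partition_on_disjoint_Un partition_on_image q' p' inj_e inj_e')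
  have "card (?e ` B) = 2" if "B \<in> q" for B
  proof -
    have "B \<subseteq> points k r" using that partition_onD1[OF q'] by blast
    then show ?thesis using card_image[OF inj_on_subset[OF inj_e]] card_q that by simp
  qed
  moreover have "card (?e' ` B) = 2" if "B \<in> p" for B
  proof -
    have "B \<subseteq> points r l" using that partition_onD1[OF p'] by blast
    then show ?thesis using card_image[OF inj_on_subset[OF inj_e']] card_p that by simp
  qed
  ultimately have card_P: "\<forall>B\<in>?P. card B = 2" by blast
  have lower: "?a z \<in> ?A" "?b z \<in> ?A" if z: "z \<in> grid r" for z
  proof -
    obtain x y where [simp]: "z = (x, y)" by fastforce
    have "?a z = ?e (Lower x y)" "Lower x y \<in> points k r" using z by auto
    then show "?a z \<in> ?A" by (metis UnI1 imageI)
    have "?b z = ?e' (Upper x y)" "Upper x y \<in> points r l" using z by auto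
    then show "?b z \<in> ?A" by (metis UnI2 imageI)
  qed
  have outer: "?A - (?a ` grid r \<union> ?b ` grid r) = points k l" (is "?L = _")
  proof (intro equalityI subsetI)
    fix z assume "z \<in> ?L"
    then show "z \<in> points k l" by (cases z) (auto simp: points_def image_iff)
  next
    fix z assume z: "z \<in> points k l"
    then have "z \<notin> ?a ` grid r \<union> ?b ` grid r" by auto
    moreover have "z \<in> ?A"
    proof (cases z)
      case (Upper x y)
      with z have "z \<in> points k r" "?e z = z" by auto
      then show ?thesis by (metis UnI1 imageI)
    next
      case (Lower x y)
      with z have "z \<in> points r l" "?e' z = z" by auto
      then show ?thesis by (metis UnI2 imageI)
    qed (use z in simp)
    ultimately show "z \<in> ?L" by blast
  qed
  have "\<exists>Q. partition_on (?A - (?a ` grid r \<union> ?b ` grid r)) Q \<and> (\<forall>B\<in>Q. card B = 2) \<and>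
    (\<forall>f. compatible Q f \<longleftrightarrow> (\<exists>g. (\<forall>z\<in>?A - (?a ` grid r \<union> ?b ` grid r). g z = f z) \<and>
      (\<forall>i\<in>grid r. g (?a i) = g (?b i)) \<and> compatible ?P g))"
  proof (intro contract_pairs P card_P)
    show "?a ` grid r \<subseteq> ?A" by (rule image_subsetI, rule lower(1))
    show "?b ` grid r \<subseteq> ?A" by (rule image_subsetI, rule lower(2))
    show "?a ` grid r \<inter> ?b ` grid r = {}" by auto
  qed (auto simp: inj_on_def)
  then obtain Q where "partition_on (points k l) Q \<and> (\<forall>B\<in>Q. card B = 2) \<and>
    (\<forall>f. compatible Q f \<longleftrightarrow> (\<exists>g. (\<forall>z\<in>points k l. g z = f z) \<and>
      (\<forall>i\<in>grid r. g (?a i) = g (?b i)) \<and> compatible ?P g))"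
    unfolding outer by (rule exE)
  then have Q: "partition_on (points k l) Q" and card_Q: "\<forall>B\<in>Q. card B = 2"
    and compat_Q: "\<forall>f. compatible Q f \<longleftrightarrow> (\<exists>g. (\<forall>z\<in>points k l. g z = f z) \<and>
      (\<forall>i\<in>grid r. g (?a i) = g (?b i)) \<and> compatible ?P g)"
    by - (elim conjE, assumption)+
  have "sem Q u d \<longleftrightarrow> (\<exists>m. sem q u m \<and> sem p m d)" for u d
  proof
    assume "sem Q u d"
    then obtain g where g: "\<forall>z\<in>points k l. g z = lab u (\<lambda>_. False) d z"
        "\<forall>i\<in>grid r. g (?a i) = g (?b i)" "compatible ?P g"
      unfolding sem_def compat_Q[rule_format] by (elim exE conjE)
    \<comment> \<open>Middle labels are read off the copies on levels 1 and 2; the contraction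
      condition transfers them to the copies that belong to \<open>p\<close>.\<close>
    let ?m = "\<lambda>(x, y). g (Middle x y)"
    have g': "compatible q (g \<circ> ?e)" "compatible p (g \<circ> ?e')"
      using g(3) by (simp_all add: compatible_Un compatible_image)
    have "compatible q (lab u (\<lambda>_. False) ?m) = compatible q (g \<circ> ?e)"
    proof (rule compatible_partition_cong[OF q'])
      fix z assume z: "z \<in> points k r"
      show "lab u (\<lambda>_. False) ?m z = (g \<circ> ?e) z"
      proof (cases z)
        case (Upper x y)
        with z have "z \<in> points k l" by simp
        with g(1) Upper show ?thesis by fastforce
      qed (use z in auto)
    qed
    moreover have "compatible p (lab ?m (\<lambda>_. False) d) = compatible p (g \<circ> ?e')"
    proof (rule compatible_partition_cong[OF p'])
      fix z assume z: "z \<in> points r l"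
      show "lab ?m (\<lambda>_. False) d z = (g \<circ> ?e') z"
      proof (cases z)
        case (Upper x y)
        then have "(x, y) \<in> grid r" using z by simp
        with g(2) have "g (?a (x, y)) = g (?b (x, y))" by (rule bspec)
        with Upper show ?thesis by simp
      next
        case (Lower x y)
        with z have "z \<in> points k l" by simp
        with g(1) Lower show ?thesis by fastforce
      qed (use z in auto)
    qed
    ultimately show "\<exists>m. sem q u m \<and> sem p m d"
      using g' by (intro exI[of _ ?m]) (simp add: sem_def)
  next
    assume "\<exists>m. sem q u m \<and> sem p m d"
    then obtain m where m: "sem q u m" "sem p m d" by blast
    \<comment> \<open>Levels 3 and 4 are folded back onto 1 and 2, so both copies of a middle point
      receive the same label.\<close>
    let ?g = "lab u (\<lambda>(x, y). m (x, if y \<le> 2 then y else y - 2)) d"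
    have "compatible q (?g \<circ> ?e) = sem q u m"
      unfolding sem_def
    proof (rule compatible_partition_cong[OF q'])
      show "(?g \<circ> ?e) z = lab u (\<lambda>_. False) m z" if "z \<in> points k r" for z
        using that by (cases z) auto
    qed
    moreover have "compatible p (?g \<circ> ?e') = sem p m d"
      unfolding sem_def
    proof (rule compatible_partition_cong[OF p'])
      show "(?g \<circ> ?e') z = lab m (\<lambda>_. False) d z" if "z \<in> points r l" for z
        using that by (cases z) auto
    qed
    ultimately have "compatible ?P ?g" using m by (simp add: compatible_Un compatible_image)
    moreover have "?g z = lab u (\<lambda>_. False) d z" if "z \<in> points k l" for z
      using that by (cases z) auto
    moreover have "?g (?a i) = ?g (?b i)" if "i \<in> grid r" for i
      using that by auto
    ultimately show "sem Q u d"
      unfolding sem_def compat_Q[rule_format] by (intro exI[of _ ?g] conjI ballI)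
  qed
  then have "sem Q = sem (compose p q)"
    by (intro ext) (simp add: sem_compose[OF q p])
  then have "Q = compose p q"
    using Q by (intro SP_eqI[OF _ compose_SP[OF q p]]) (simp_all add: SP_partition)
  with card_Q show ?thesis by simp
qed

section \<open>Closure of pair partitions under the category operations\<close>

lemma tensor_pairs:
  assumes "\<forall>B\<in>p. card B = 2" "\<forall>B\<in>q. card B = 2"
  shows "\<forall>B\<in>tensor k l p q. card B = 2"
  using assms by (auto simp: tensor_def card_image[OF inj_on_subset[OF inj_shift]])

lemma involution_pairs: "\<forall>B\<in>p. card B = 2 \<Longrightarrow> \<forall>B\<in>involution p. card B = 2"
  by (auto simp: involution_def card_image[OF inj_on_subset[OF inj_flip]])

lemma generators_pairs:
  "\<forall>B\<in>base_id. card B = 2" "\<forall>B\<in>base_pair. card B = 2" "\<forall>B\<in>part_a. card B = 2"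
  "\<forall>B\<in>part_c i. card B = 2" "\<forall>B\<in>part_d i. card B = 2"
  by (simp_all add: base_id_def base_pair_def part_a_def part_c_def part_d_def through_pairs_def)

lemma spatial_pair_partitions_iff:
  "p \<in> spatial_pair_partitions \<longleftrightarrow> (\<exists>k l. p \<in> SP k l) \<and> (\<forall>B\<in>p. card B = 2)"
  by (simp add: spatial_pair_partitions_def spatial_partitions_iff)

lemma is_category_spatial_pair_partitions: "is_category spatial_pair_partitions"
  unfolding is_category_def
proof (intro conjI allI impI ballI)
  show "spatial_pair_partitions \<subseteq> spatial_partitions"
    by (auto simp: spatial_pair_partitions_def)
  show "base_id \<in> spatial_pair_partitions"
    unfolding spatial_pair_partitions_iff using generators_SP(1) generators_pairs(1) by (intro conjI exI)
  show "base_pair \<in> spatial_pair_partitions"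
    unfolding spatial_pair_partitions_iff using generators_SP(2) generators_pairs(2) by (intro conjI exI)
  fix k l r p q
  show "tensor k l p q \<in> spatial_pair_partitions"
    if "p \<in> spatial_pair_partitions \<and> p \<in> SP k l \<and> q \<in> spatial_pair_partitions"
  proof -
    from that obtain k' l' where "q \<in> SP k' l'"
      unfolding spatial_pair_partitions_iff by (elim conjE exE)
    with that have "tensor k l p q \<in> SP (k + k') (l + l')" by (intro tensor_SP) (elim conjE)
    moreover have "\<forall>B\<in>tensor k l p q. card B = 2"
      using that by (intro tensor_pairs) (simp_all add: spatial_pair_partitions_iff)
    ultimately show ?thesis unfolding spatial_pair_partitions_iff by (intro conjI exI)
  qed
  show "compose p q \<in> spatial_pair_partitions"
    if "q \<in> spatial_pair_partitions \<and> q \<in> SP k r \<and> p \<in> spatial_pair_partitions \<and> p \<in> SP r l"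
  proof -
    from that have "compose p q \<in> SP k l" by (intro compose_SP[of q k r p l]) (elim conjE, assumption)+
    moreover have "\<forall>B\<in>compose p q. card B = 2"
      using that by (intro compose_pairs[of q k r p l]) (simp_all add: spatial_pair_partitions_iff)
    ultimately show ?thesis unfolding spatial_pair_partitions_iff by (intro conjI exI)
  qed
  show "involution p \<in> spatial_pair_partitions" if "p \<in> spatial_pair_partitions"
  proof -
    from that obtain k l where "p \<in> SP k l"
      unfolding spatial_pair_partitions_iff by (elim conjE exE)
    then have "involution p \<in> SP l k" by (rule involution_SP)
    moreover have "\<forall>B\<in>involution p. card B = 2"
      using that by (intro involution_pairs) (simp add: spatial_pair_partitions_iff)
    ultimately show ?thesis unfolding spatial_pair_partitions_iff by (intro conjI exI)
  qed
qed

section \<open>Relations realized in a category\<close>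

text \<open>The labelling that the right factor of a tensor product sees.\<close>

definition drop_columns :: "nat \<Rightarrow> (nat \<times> nat \<Rightarrow> bool) \<Rightarrow> nat \<times> nat \<Rightarrow> bool" where
  "drop_columns n f = (\<lambda>(x, y). f (n + x, y))"

text \<open>The relation of \<open>n\<close> identity columns.\<close>

definition agree :: "nat \<Rightarrow> (nat \<times> nat \<Rightarrow> bool) \<Rightarrow> (nat \<times> nat \<Rightarrow> bool) \<Rightarrow> bool" where
  "agree n u d \<longleftrightarrow> (\<forall>z\<in>grid n. u z = d z)"

lemma drop_columns_apply [simp]: "drop_columns n f (x, y) = f (n + x, y)"
  by (simp add: drop_columns_def)

lemma drop_columns_0 [simp]: "drop_columns 0 f = f"
  by (simp add: fun_eq_iff)

lemma drop_columns_drop_columns [simp]: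
  "drop_columns n (drop_columns m f) = drop_columns (m + n) f"
  by (simp add: fun_eq_iff add.assoc)

lemma agreeI: "(\<And>x y. (x, y) \<in> grid n \<Longrightarrow> u (x, y) = d (x, y)) \<Longrightarrow> agree n u d"
  by (simp only: agree_def split_paired_Ball_Sigma) blast

lemma agreeD: "agree n u d \<Longrightarrow> z \<in> grid n \<Longrightarrow> u z = d z"
  unfolding agree_def by (rule bspec)

lemma agree_refl [simp]: "agree n u u"
  by (simp add: agree_def)

lemma agree_0 [simp]: "agree 0 u d"
  by (simp add: agree_def)

lemma agree_1: "agree 1 u d \<longleftrightarrow> u (1, 1) = d (1, 1) \<and> u (1, 2) = d (1, 2)"
  by (auto simp: agree_def)

lemma agree_2: "agree 2 u d \<longleftrightarrow>
    u (1, 1) = d (1, 1) \<and> u (1, 2) = d (1, 2) \<and> u (2, 1) = d (2, 1) \<and> u (2, 2) = d (2, 2)"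
proof -
  have "{1..2::nat} = {1, 2}" by auto
  then show ?thesis by (simp add: agree_def)
qed

lemma grid_add: "grid (m + n) = grid m \<union> (\<lambda>(x, y). (m + x, y)) ` grid n"
proof (intro equalityI subsetI)
  fix z assume "z \<in> grid (m + n)"
  then obtain x y where z: "z = (x, y)" "x \<in> {1..m + n}" "y \<in> {1, 2}" by blast
  show "z \<in> grid m \<union> (\<lambda>(x, y). (m + x, y)) ` grid n"
  proof (cases "x \<le> m")
    case False
    then have "z = (\<lambda>(x, y). (m + x, y)) (x - m, y)" "(x - m, y) \<in> grid n" using z by auto
    then show ?thesis by blast
  qed (use z in auto)
qed auto

lemma agree_add: "agree (m + n) u d \<longleftrightarrow> agree m u d \<and> agree n (drop_columns m u) (drop_columns m d)"
  unfolding agree_def grid_add ball_Un by (simp add: case_prod_beta drop_columns_def del: insert_iff)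

lemma sem_tensor_drop_columns:
  "sem (tensor k l p q) u d \<longleftrightarrow> sem p u d \<and> sem q (drop_columns k u) (drop_columns l d)"
  by (simp add: sem_tensor drop_columns_def)

lemma sem_base_id: "sem base_id = agree 1"
  by (intro ext, unfold agree_1) (auto simp: sem_def compatible_def base_id_def)

lemma sem_base_pair: "sem base_pair u d \<longleftrightarrow> d (1, 1) = d (2, 1) \<and> d (1, 2) = d (2, 2)"
  by (auto simp: sem_def compatible_def base_pair_def)

lemma sem_part_a: "sem part_a u d \<longleftrightarrow> d (1, 1) = d (1, 2)"
  by (auto simp: sem_def compatible_def part_a_def)

lemma sem_part_s: "sem part_s u d"
  by (auto simp: sem_def compatible_def part_s_def)

lemma sem_part_c:
  "i \<in> {1, 2} \<Longrightarrow> sem (part_c i) u d \<longleftrightarrow> agree 2 u (d \<circ> transpose (1, i) (2, i))"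
  by (auto simp: sem_def compatible_def part_c_def through_pairs_def agree_2 transpose_def)

lemma sem_part_f: "i \<in> {1, 2} \<Longrightarrow> sem (part_f i) u d \<longleftrightarrow> agree 2 u d \<and> d (1, i) = d (2, i)"
  by (auto simp: sem_def compatible_def part_f_def through_pairs_def agree_2)

section \<open>Unrolling to a single row, and pairings\<close>

definition join :: "nat \<Rightarrow> (nat \<times> nat \<Rightarrow> bool) \<Rightarrow> (nat \<times> nat \<Rightarrow> bool) \<Rightarrow> nat \<times> nat \<Rightarrow> bool" where
  "join k u d = (\<lambda>(x, y). if x \<le> k then u (x, y) else d (x - k, y))"

text \<open>Upper columns keep their order instead of being reversed, so the arcs that bend them
  join column \<open>x\<close> to column \<open>k + x\<close> and cross one another.\<close>

fun unroll :: "nat \<Rightarrow> point \<Rightarrow> nat \<times> nat" where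
  "unroll k (Upper x y) = (x, y)"
| "unroll k (Middle x y) = (0, y)"
| "unroll k (Lower x y) = (k + x, y)"

lemma inj_on_unroll: "inj_on (unroll k) (points k l)"
proof (rule inj_onI)
  show "z = z'" if "z \<in> points k l" "z' \<in> points k l" "unroll k z = unroll k z'" for z z'
    using that by (cases z; cases z') auto
qed

lemma unroll_points: "unroll k ` points k l = grid (k + l)"
proof (intro equalityI subsetI)
  show "w \<in> grid (k + l)" if "w \<in> unroll k ` points k l" for w
    using that by (auto simp: points_def)
next
  fix w assume "w \<in> grid (k + l)"
  then obtain x y where w: "w = (x, y)" "x \<in> {1..k + l}" "y \<in> {1, 2}" by blast
  show "w \<in> unroll k ` points k l"
  proof (cases "x \<le> k")
    case True
    then have "w = unroll k (Upper x y)" "Upper x y \<in> points k l" using w by auto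
    then show ?thesis by blast
  next
    case False
    then have "w = unroll k (Lower (x - k) y)" "Lower (x - k) y \<in> points k l" using w by auto
    then show ?thesis by blast
  qed
qed

lemma sem_unroll:
  assumes "p \<in> SP k l"
  shows "sem p u d \<longleftrightarrow> compatible ((`) (unroll k) ` p) (join k u d)"
  unfolding sem_def compatible_image
proof (rule compatible_partition_cong)
  show "partition_on (points k l) p" using assms by (simp add: SP_partition)
  show "lab u (\<lambda>_. False) d z = (join k u d \<circ> unroll k) z" if "z \<in> points k l" for z
    using that by (cases z) (auto simp: join_def)
qed

text \<open>Pair partitions of the grid, encoded as fixed-point-free involutions so that permuting
  points becomes conjugation.\<close>

definition pairing :: "nat \<Rightarrow> (nat \<times> nat \<Rightarrow> nat \<times> nat) \<Rightarrow> bool" where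
  "pairing n t \<longleftrightarrow> (\<forall>z\<in>grid n. t z \<in> grid n \<and> t z \<noteq> z \<and> t (t z) = z)"

lemma pairingD:
  assumes "pairing n t" "z \<in> grid n"
  shows "t z \<in> grid n" "t z \<noteq> z" "t (t z) = z"
  using assms unfolding pairing_def by blast+

lemma transpose_grid: "a \<in> grid n \<Longrightarrow> b \<in> grid n \<Longrightarrow> z \<in> grid n \<Longrightarrow> transpose a b z \<in> grid n"
  by (simp add: transpose_def)

lemma pairing_conj:
  assumes t: "pairing n t" and ab: "a \<in> grid n" "b \<in> grid n"
  shows "pairing n (transpose a b \<circ> t \<circ> transpose a b)"
  unfolding pairing_def
proof (intro ballI conjI)
  fix z assume "z \<in> grid n"
  note z = transpose_grid[OF ab this]
  show "(transpose a b \<circ> t \<circ> transpose a b) z \<in> grid n"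
    using transpose_grid[OF ab] pairingD(1)[OF t z] by simp
  show "(transpose a b \<circ> t \<circ> transpose a b) z \<noteq> z"
    using pairingD(2)[OF t z] by (metis comp_apply transpose_involutory)
  show "(transpose a b \<circ> t \<circ> transpose a b) ((transpose a b \<circ> t \<circ> transpose a b) z) = z"
    using pairingD(3)[OF t z] by simp
qed

text \<open>Compatibility with the blocks \<open>{z, t z}\<close>.\<close>

definition fixed_by :: "nat \<Rightarrow> (nat \<times> nat \<Rightarrow> nat \<times> nat) \<Rightarrow> (nat \<times> nat \<Rightarrow> bool) \<Rightarrow> bool" where
  "fixed_by n t d \<longleftrightarrow> (\<forall>z\<in>grid n. d z = d (t z))"

text \<open>An involution that preserves the last \<open>n\<close> columns also preserves the first
  \<open>m\<close>, so its pair partition splits as a tensor product. The map \<open>s\<close> is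
  the action of \<open>t\<close> on the last columns, renumbered from 1.\<close>

lemma pairing_add:
  assumes t: "pairing (m + n) t"
    and s: "\<And>x y. (x, y) \<in> grid n \<Longrightarrow> s (x, y) \<in> grid n \<and> t (m + x, y) = (case s (x, y) of (x', y') \<Rightarrow> (m + x', y'))"
  shows "pairing m t"
    and "fixed_by (m + n) t d \<longleftrightarrow> fixed_by m t d \<and> fixed_by n s (drop_columns m d)"
proof -
  show "pairing m t"
    unfolding pairing_def
  proof (intro ballI conjI)
    fix z assume z: "z \<in> grid m"
    then have z': "z \<in> grid (m + n)" unfolding grid_add by (rule UnI1)
    show "t z \<noteq> z" "t (t z) = z" using pairingD[OF t z'] by simp_all
    show "t z \<in> grid m"
    proof (rule ccontr)
      assume "t z \<notin> grid m"
      then have "t z \<in> (\<lambda>(x, y). (m + x, y)) ` grid n"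
        using pairingD(1)[OF t z'] unfolding grid_add by (elim UnE) simp_all
      then obtain x y where xy: "t z = (m + x, y)" "(x, y) \<in> grid n" by auto
      obtain x' y' where "s (x, y) = (x', y')" by (cases "s (x, y)")
      with s[OF xy(2)] xy(1) pairingD(3)[OF t z'] have "z = (m + x', y')" "(x', y') \<in> grid n" by simp_all
      with z show False by simp
    qed
  qed
  have "d (m + x, y) = d (t (m + x, y)) \<longleftrightarrow> drop_columns m d (x, y) = drop_columns m d (s (x, y))"
    if "(x, y) \<in> grid n" for x y
    using s[OF that] by (cases "s (x, y)") simp
  then show "fixed_by (m + n) t d \<longleftrightarrow> fixed_by m t d \<and> fixed_by n s (drop_columns m d)"
    unfolding fixed_by_def grid_add ball_Un by (simp add: split_paired_Ball_Sigma)
qed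

lemma fixed_by_conj:
  assumes ab: "a \<in> grid n" "b \<in> grid n"
  shows "fixed_by n (transpose a b \<circ> t \<circ> transpose a b) (d \<circ> transpose a b) \<longleftrightarrow> fixed_by n t d"
proof
  assume *: "fixed_by n (transpose a b \<circ> t \<circ> transpose a b) (d \<circ> transpose a b)"
  show "fixed_by n t d" unfolding fixed_by_def
  proof (rule ballI)
    fix z assume "z \<in> grid n"
    from transpose_grid[OF ab this] *[unfolded fixed_by_def, THEN bspec, of "transpose a b z"]
    show "d z = d (t z)" by simp
  qed
next
  assume *: "fixed_by n t d"
  show "fixed_by n (transpose a b \<circ> t \<circ> transpose a b) (d \<circ> transpose a b)" unfolding fixed_by_def
  proof (rule ballI)
    fix z assume "z \<in> grid n"
    from *[unfolded fixed_by_def, THEN bspec, OF transpose_grid[OF ab this]]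
    show "(d \<circ> transpose a b) z = (d \<circ> transpose a b) ((transpose a b \<circ> t \<circ> transpose a b) z)" by simp
  qed
qed

section \<open>Closure properties of realized relations\<close>

locale crossing_category =
  fixes C
  assumes category: "is_category C"
    and mem_a: "part_a \<in> C" and mem_c1: "part_c 1 \<in> C" and mem_c2: "part_c 2 \<in> C"
begin

text \<open>The arities have to be recorded: all partitions into singletons have the same relation,
  whatever the number of their points.\<close>

definition realized where
  "realized k l R \<longleftrightarrow> (\<exists>p\<in>C. p \<in> SP k l \<and> sem p = R)"

lemma realizedI: "p \<in> C \<Longrightarrow> p \<in> SP k l \<Longrightarrow> (\<And>u d. sem p u d \<longleftrightarrow> R u d) \<Longrightarrow> realized k l R"
  unfolding realized_def by (intro bexI conjI ext)

lemma realizedE: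
  assumes "realized k l R"
  obtains p where "p \<in> C" "p \<in> SP k l" "sem p = R"
  using assms unfolding realized_def by (elim bexE conjE) simp

lemma realized_eq:
  assumes "realized k l R" "\<And>u d. R u d \<longleftrightarrow> S u d"
  shows "realized k l S"
proof -
  have "R = S" using assms(2) by (intro ext)
  with assms(1) show ?thesis by simp
qed

text \<open>Relations act on labellings of all of \<open>nat \<times> nat\<close>; this locality
  permits replacing a middle labelling by one that agrees with it only on the grid.\<close>

lemma realized_cong:
  assumes "realized k l R" "agree k u u'" "agree l d d'"
  shows "R u d \<longleftrightarrow> R u' d'"
proof -
  obtain p where "p \<in> C" and p: "p \<in> SP k l" "sem p = R"
    by (rule realizedE[OF assms(1)])
  show ?thesis
    using sem_cong[OF p(1), of u u' d d'] agreeD[OF assms(2)] agreeD[OF assms(3)] unfolding p(2) by blast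
qed

lemma realized_imp_mem:
  assumes "realized k l (sem p)" "p \<in> SP k l"
  shows "p \<in> C"
proof -
  obtain q where q: "q \<in> C" "q \<in> SP k l" "sem q = sem p"
    by (rule realizedE[OF assms(1)])
  then have "q = p" using assms(2) by (intro SP_eqI)
  with q show ?thesis by simp
qed

lemma realized_compose:
  assumes "realized k r R" "realized r l S"
  shows "realized k l (\<lambda>u d. \<exists>m. R u m \<and> S m d)"
proof -
  obtain q where q: "q \<in> C" "q \<in> SP k r" "sem q = R" by (rule realizedE[OF assms(1)])
  obtain p where p: "p \<in> C" "p \<in> SP r l" "sem p = S" by (rule realizedE[OF assms(2)])
  show ?thesis
  proof (rule realizedI)
    show "compose p q \<in> C" using category p q unfolding is_category_def by blast
    show "compose p q \<in> SP k l" using q(2) p(2) by (rule compose_SP)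
    show "sem (compose p q) u d \<longleftrightarrow> (\<exists>m. R u m \<and> S m d)" for u d
      unfolding sem_compose[OF q(2) p(2)] q(3) p(3) ..
  qed
qed

lemma realized_tensor:
  assumes "realized k l R" "realized k' l' S"
  shows "realized (k + k') (l + l') (\<lambda>u d. R u d \<and> S (drop_columns k u) (drop_columns l d))"
proof -
  obtain p where p: "p \<in> C" "p \<in> SP k l" "sem p = R" by (rule realizedE[OF assms(1)])
  obtain q where q: "q \<in> C" "q \<in> SP k' l'" "sem q = S" by (rule realizedE[OF assms(2)])
  show ?thesis
  proof (rule realizedI)
    show "tensor k l p q \<in> C" using category p q unfolding is_category_def by blast
    show "tensor k l p q \<in> SP (k + k') (l + l')" using p(2) q(2) by (rule tensor_SP)
    show "sem (tensor k l p q) u d \<longleftrightarrow> R u d \<and> S (drop_columns k u) (drop_columns l d)" for u d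
      unfolding sem_tensor_drop_columns q(3) p(3) ..
  qed
qed

lemma realized_involution:
  assumes "realized k l R"
  shows "realized l k (\<lambda>u d. R d u)"
proof -
  obtain p where p: "p \<in> C" "p \<in> SP k l" "sem p = R" by (rule realizedE[OF assms])
  show ?thesis
  proof (rule realizedI)
    show "involution p \<in> C" using category p unfolding is_category_def by blast
    show "involution p \<in> SP l k" using p(2) by (rule involution_SP)
    show "sem (involution p) u d \<longleftrightarrow> R d u" for u d
      unfolding sem_involution p(3) ..
  qed
qed

lemma realized_base_pair: "realized 0 2 (\<lambda>u d. d (1, 1) = d (2, 1) \<and> d (1, 2) = d (2, 2))"
proof (rule realizedI)
  show "base_pair \<in> C" using category unfolding is_category_def by blast
qed (rule generators_SP sem_base_pair)+

lemma realized_a: "realized 0 1 (\<lambda>u d. d (1, 1) = d (1, 2))"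
  by (rule realizedI) (rule mem_a generators_SP sem_part_a)+

lemma realized_c: "i \<in> {1, 2} \<Longrightarrow> realized 2 2 (\<lambda>u d. agree 2 u (d \<circ> transpose (1, i) (2, i)))"
  using mem_c1 mem_c2 by (intro realizedI[of "part_c i"] generators_SP sem_part_c) auto

text \<open>The base pair closed off by its involution gives one loop on each level, and loops are
  deleted. The constant labelling witnesses that they impose no condition.\<close>

lemma realized_empty: "realized 0 0 (\<lambda>u d. True)"
  by (rule realized_eq[OF realized_compose[OF realized_base_pair realized_involution[OF realized_base_pair]]])
    (simp only: simp_thms, rule exI[of _ "\<lambda>_. True"], simp)

lemma realized_id: "realized n n (agree n)"
proof (induction n)
  case 0
  show ?case by (rule realized_eq[OF realized_empty]) simp
next
  case (Suc n)
  have "realized 1 1 (agree 1)"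
  proof (rule realizedI)
    show "base_id \<in> C" using category unfolding is_category_def by blast
  qed (simp_all add: generators_SP[simplified] sem_base_id[simplified])
  from realized_tensor[OF Suc this]
  have "realized (n + 1) (n + 1) (agree (n + 1))" by (rule realized_eq) (simp only: agree_add)
  then show ?case by simp
qed

lemma realized_place:
  assumes "realized w w' R"
  shows "realized (i + w + j) (i + w' + j) (\<lambda>u d. agree i u d \<and> R (drop_columns i u) (drop_columns i d) \<and>
    agree j (drop_columns (i + w) u) (drop_columns (i + w') d))"
  by (rule realized_eq[OF realized_tensor[OF realized_tensor[OF realized_id assms] realized_id]]) simp

text \<open>A partition whose relation lies below the identity acts as a test: composing with it on
  the columns \<open>i + 1\<close> to \<open>i + w\<close> intersects the relation with a condition
  on the lower labels.\<close>

lemma realized_filter: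
  assumes R: "realized k (i + w + j) R" and G: "realized w w (\<lambda>u d. agree w u d \<and> G d)"
  shows "realized k (i + w + j) (\<lambda>u d. R u d \<and> G (drop_columns i d))"
proof (rule realized_eq[OF realized_compose[OF R realized_place[OF G]]])
  fix u d
  have "agree i m d \<and> (agree w (drop_columns i m) (drop_columns i d) \<and> G (drop_columns i d)) \<and>
      agree j (drop_columns (i + w) m) (drop_columns (i + w) d) \<longleftrightarrow> agree (i + w + j) m d \<and> G (drop_columns i d)" for m
    by (auto simp only: agree_add)
  moreover have "R u m \<longleftrightarrow> R u d" if "agree (i + w + j) m d" for m
    by (rule realized_cong[OF R agree_refl that])
  ultimately show "(\<exists>m. R u m \<and> agree i m d \<and>
      (agree w (drop_columns i m) (drop_columns i d) \<and> G (drop_columns i d)) \<and>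
      agree j (drop_columns (i + w) m) (drop_columns (i + w) d)) \<longleftrightarrow> R u d \<and> G (drop_columns i d)"
    using agree_refl[of "i + w + j" d] by metis
qed

lemma realized_adjacent_transpose:
  assumes R: "realized k n R" and i: "i \<in> {1, 2}" and x: "1 \<le> x" "x < n"
  shows "realized k n (\<lambda>u d. R u (d \<circ> transpose (x, i) (Suc x, i)))"
proof -
  \<comment> \<open>The crossing occupies columns \<open>x\<close> and \<open>x + 1\<close>, with
    \<open>h\<close> columns to its left and \<open>j\<close> to its right.\<close>
  define h where "h = x - 1"
  define j where "j = n - Suc x"
  have n: "n = h + 2 + j" and [simp]: "x = h + 1" using x by (auto simp: h_def j_def)
  let ?t = "transpose (x, i) (Suc x, i)"
  have S: "agree h m d \<and> agree 2 (drop_columns h m) (drop_columns h d \<circ> transpose (1, i) (2, i)) \<and>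
      agree j (drop_columns (h + 2) m) (drop_columns (h + 2) d) \<longleftrightarrow> agree n m (d \<circ> ?t)" for m d
  proof -
    have "agree h m d = agree h m (d \<circ> ?t)" by (auto simp: agree_def transpose_def)
    moreover have "drop_columns h d \<circ> transpose (1, i) (2, i) = drop_columns h (d \<circ> ?t)"
      by (auto simp: fun_eq_iff transpose_def)
    moreover have "agree j (drop_columns (h + 2) m) (drop_columns (h + 2) d) =
        agree j (drop_columns (h + 2) m) (drop_columns (h + 2) (d \<circ> ?t))"
      by (auto simp: agree_def transpose_def)
    ultimately show ?thesis unfolding n agree_add by simp
  qed
  show ?thesis
  proof (rule realized_eq[OF realized_compose[OF R realized_place[OF realized_c[OF i], of h j, folded n]]])
    fix u d
    have "R u m \<longleftrightarrow> R u (d \<circ> ?t)" if "agree n m (d \<circ> ?t)" for m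
      by (rule realized_cong[OF R agree_refl that])
    then show "(\<exists>m. R u m \<and> agree h m d \<and>
        agree 2 (drop_columns h m) (drop_columns h d \<circ> transpose (1, i) (2, i)) \<and>
        agree j (drop_columns (h + 2) m) (drop_columns (h + 2) d)) \<longleftrightarrow> R u (d \<circ> ?t)"
      unfolding S using agree_refl[of n "d \<circ> ?t"] by metis
  qed
qed

text \<open>Conjugating the transposition of columns \<open>a\<close> and \<open>b\<close> by the
  adjacent one of \<open>b\<close> and \<open>b + 1\<close> gives that of \<open>a\<close> and
  \<open>b + 1\<close>. The induction generalizes over \<open>R\<close> because its hypothesis is
  applied to an already permuted relation.\<close>

lemma realized_less_transpose:
  assumes R: "realized k n R" and i: "i \<in> {1, 2}" and ab: "1 \<le> a" "a < b" "b \<le> n"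
  shows "realized k n (\<lambda>u d. R u (d \<circ> transpose (a, i) (b, i)))"
proof -
  have "Suc a \<le> b" using ab by simp
  then show ?thesis using R ab(3)
  proof (induction b arbitrary: R rule: dec_induct)
    case base
    then show ?case using realized_adjacent_transpose[OF base(1) i ab(1)] by simp
  next
    case (step b)
    let ?s = "transpose (b, i) (Suc b, i)" and ?t = "transpose (a, i) (b, i)"
    have b: "1 \<le> b" "b < n" "b \<le> n" using step.hyps step.prems(2) by auto
    have "realized k n (\<lambda>u d. R u (d \<circ> ?s \<circ> ?t \<circ> ?s))"
      using realized_adjacent_transpose[OF step.IH[OF realized_adjacent_transpose[OF step.prems(1) i b(1,2)] b(3)] i b(1,2)] .
    moreover have "?s \<circ> ?t \<circ> ?s = transpose (a, i) (Suc b, i)"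
      using step.hyps by (auto simp: fun_eq_iff transpose_def)
    ultimately show ?case by (simp only: comp_assoc)
  qed
qed

lemma realized_transpose:
  assumes R: "realized k n R" and ab: "(a, i) \<in> grid n" "(b, i) \<in> grid n"
  shows "realized k n (\<lambda>u d. R u (d \<circ> transpose (a, i) (b, i)))"
proof -
  have i: "i \<in> {1, 2}" and n: "1 \<le> a" "1 \<le> b" "a \<le> n" "b \<le> n" using ab by auto
  consider "a < b" | "b < a" | "a = b" by linarith
  then show ?thesis
  proof cases
    case 1
    then show ?thesis using realized_less_transpose[OF R i n(1) _ n(4)] by simp
  next
    case 2
    then show ?thesis using realized_less_transpose[OF R i n(2) _ n(3)] by (simp add: transpose_commute)
  qed (use R in simp)
qed

text \<open>Permuting the labels undoes the conjugation, so a pairing may be normalized by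
  transpositions within a level before it is realized.\<close>

lemma realized_pairing_conj:
  assumes "realized 0 n (\<lambda>u. fixed_by n (transpose (a, i) (b, i) \<circ> t \<circ> transpose (a, i) (b, i)))"
    and ab: "(a, i) \<in> grid n" "(b, i) \<in> grid n"
  shows "realized 0 n (\<lambda>u. fixed_by n t)"
  using realized_transpose[OF assms] unfolding fixed_by_conj[OF ab] .

lemma realized_pairing_columns:
  assumes IH: "pairing m t \<Longrightarrow> realized 0 m (\<lambda>u. fixed_by m t)"
    and t: "pairing (m + 1) t" "t (m + 1, 1) = (m + 1, 2)"
  shows "realized 0 (m + 1) (\<lambda>u. fixed_by (m + 1) t)"
proof -
  \<comment> \<open>The map \<open>3 - y\<close> exchanges the two levels of the last column, which
    is the block of \<open>part_a\<close>.\<close>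
  let ?s = "\<lambda>(x, y). (x, 3 - y)"
  have "t (m + 1, 2) = (m + 1, 1)" using pairingD(3)[OF t(1), of "(m + 1, 1)"] t(2) by simp
  then have "?s (x, y) \<in> grid 1 \<and> t (m + x, y) = (case ?s (x, y) of (x', y') \<Rightarrow> (m + x', y'))"
    if "(x, y) \<in> grid 1" for x y
    using that t(2) by auto
  note restrict = pairing_add[where s = ?s, OF t(1) this]
  have "fixed_by 1 ?s d \<longleftrightarrow> d (1, 1) = d (1, 2)" for d
    by (auto simp: fixed_by_def)
  then have "realized 0 1 (\<lambda>u. fixed_by 1 ?s)" by (rule realized_eq[OF realized_a sym])
  with IH[OF restrict(1)]
  have "realized (0 + 0) (m + 1) (\<lambda>u d. fixed_by m t d \<and> fixed_by 1 ?s (drop_columns m d))"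
    by (rule realized_tensor)
  then have "realized (0 + 0) (m + 1) (\<lambda>u. fixed_by (m + 1) t)"
    by (rule realized_eq) (simp only: restrict(2))
  then show ?thesis by simp
qed

lemma realized_pairing_column_pairs:
  assumes IH: "pairing m t \<Longrightarrow> realized 0 m (\<lambda>u. fixed_by m t)"
    and t: "pairing (m + 2) t" "t (m + 2, 1) = (m + 1, 1)" "t (m + 2, 2) = (m + 1, 2)"
  shows "realized 0 (m + 2) (\<lambda>u. fixed_by (m + 2) t)"
proof -
  \<comment> \<open>The map \<open>3 - x\<close> exchanges the last two columns on each level, which
    is the base pair.\<close>
  let ?s = "\<lambda>(x, y). (3 - x, y)"
  have t': "t (m + 1, 1) = (m + 2, 1)" "t (m + 1, 2) = (m + 2, 2)"
    using pairingD(3)[OF t(1), of "(m + 2, 1)"] pairingD(3)[OF t(1), of "(m + 2, 2)"] t(2,3) by simp_all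
  have two: "{1..2::nat} = {1, 2}" by auto
  have "?s (x, y) \<in> grid 2 \<and> t (m + x, y) = (case ?s (x, y) of (x', y') \<Rightarrow> (m + x', y'))"
    if "(x, y) \<in> grid 2" for x y
  proof -
    have "(x, y) \<in> {(1, 1), (1, 2), (2, 1), (2, 2)}" using that unfolding two by auto
    then show ?thesis unfolding two by (elim insertE emptyE) (simp_all add: t(2,3)[simplified] t'[simplified])
  qed
  note restrict = pairing_add[where s = ?s, OF t(1) this]
  have "fixed_by 2 ?s d \<longleftrightarrow> d (1, 1) = d (2, 1) \<and> d (1, 2) = d (2, 2)" for d
    unfolding fixed_by_def two by (simp add: eq_commute) blast
  then have "realized 0 2 (\<lambda>u. fixed_by 2 ?s)" by (rule realized_eq[OF realized_base_pair sym])
  with IH[OF restrict(1)]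
  have "realized (0 + 0) (m + 2) (\<lambda>u d. fixed_by m t d \<and> fixed_by 2 ?s (drop_columns m d))"
    by (rule realized_tensor)
  then have "realized (0 + 0) (m + 2) (\<lambda>u. fixed_by (m + 2) t)"
    by (rule realized_eq) (simp only: restrict(2))
  then show ?thesis by simp
qed

text \<open>The partner \<open>(x, 2)\<close> is moved within level 2 to the last column, where
  \<open>part_a\<close> splits off.\<close>

lemma realized_pairing_cross:
  assumes IH: "\<And>t. pairing m t \<Longrightarrow> realized 0 m (\<lambda>u. fixed_by m t)"
    and t: "pairing (m + 1) t" "t (m + 1, 1) = (x, 2)"
  shows "realized 0 (m + 1) (\<lambda>u. fixed_by (m + 1) t)"
proof (rule realized_pairing_conj)
  have top: "(m + 1, 1) \<in> grid (m + 1)" by simp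
  show x: "(x, 2) \<in> grid (m + 1)" using pairingD(1)[OF t(1) top] t(2) by simp
  show y: "(m + 1, 2) \<in> grid (m + 1)" by simp
  let ?t = "transpose (x, 2) (m + 1, 2)"
  show "realized 0 (m + 1) (\<lambda>u. fixed_by (m + 1) (?t \<circ> t \<circ> ?t))"
    by (rule realized_pairing_columns[OF IH pairing_conj[OF t(1) x y]]) (use t(2) in simp_all)
qed

text \<open>
  Conjugation by transpositions within a level turns the partner of the last point on level 1 into
  the point next to it, on the same column or on the same level; either way the last one or two
  columns split off as \<open>a\<close> or as the base pair partition.
\<close>

lemma realized_pairing: "pairing n t \<Longrightarrow> realized 0 n (\<lambda>u. fixed_by n t)"
proof (induction n arbitrary: t rule: less_induct)
  case (less n)
  note t = less.prems
  show ?case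
  proof (cases n)
    case 0
    have "realized 0 0 (\<lambda>u. fixed_by 0 t)" by (rule realized_eq[OF realized_empty]) (simp add: fixed_by_def)
    with 0 show ?thesis by simp
  next
    case (Suc m)
    then have n: "n = m + 1" "m < n" by simp_all
    have top: "(n, 1) \<in> grid n" "(n, 2) \<in> grid n" using n by auto
    have IH: "realized 0 m (\<lambda>u. fixed_by m s)" if "pairing m s" for s
      using n(2) that by (rule less.IH)
    have cross: "realized 0 n (\<lambda>u. fixed_by n s)" if s: "pairing n s" "s (n, 1) = (x, 2)" for s x
      by (rule realized_pairing_cross[of m s x, folded n(1)]) (erule IH, rule s, rule s)
    obtain x j where tx: "t (n, 1) = (x, j)" by (cases "t (n, 1)")
    obtain x' j' where tx': "t (n, 2) = (x', j')" by (cases "t (n, 2)")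
    have xj: "(x, j) \<in> grid n" "(x', j') \<in> grid n"
      using pairingD(1)[OF t top(1)] pairingD(1)[OF t top(2)] tx tx' by simp_all
    consider "j = 2" | "j = 1" "j' = 1" | "j = 1" "j' = 2" using xj by auto
    then show ?thesis
    proof cases
      case 1
      then show ?thesis using cross[OF t] tx by simp
    next
      case 2
      \<comment> \<open>Moving the level 1 partner of \<open>(n, 2)\<close> to \<open>(n, 1)\<close>
        reduces this to a pairing that joins the two points of the last column.\<close>
      have x': "(x', 1) \<in> grid n" using xj(2) 2 by simp
      show ?thesis
      proof (rule realized_pairing_conj[OF cross x' top(1)])
        show "pairing n (transpose (x', 1) (n, 1) \<circ> t \<circ> transpose (x', 1) (n, 1))"
          by (rule pairing_conj[OF t x' top(1)])
        have "t (x', 1) = (n, 2)" using pairingD(3)[OF t top(2)] tx' 2 by simp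
        then show "(transpose (x', 1) (n, 1) \<circ> t \<circ> transpose (x', 1) (n, 1)) (n, 1) = (n, 2)"
          by simp
      qed
    next
      case 3
      have ne: "x \<noteq> n" "x' \<noteq> n"
        using pairingD(2)[OF t top(1)] pairingD(2)[OF t top(2)] tx tx' 3 by auto
      have x: "(x, 1) \<in> grid n" and x': "(x', 2) \<in> grid n" using xj 3 by simp_all
      \<comment> \<open>Neither partner is in column \<open>n\<close>, so \<open>n\<close> is at
        least 2; both are moved to column \<open>h + 1\<close>, the last but one.\<close>
      define h where "h = n - 2"
      have h: "n = h + 2" "h < n" using x ne by (auto simp: h_def)
      have y: "(h + 1, 1) \<in> grid n" "(h + 1, 2) \<in> grid n" using h by auto
      let ?t1 = "transpose (x, 1) (h + 1, 1)" and ?t2 = "transpose (x', 2) (h + 1, 2)"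
      define t1 where "t1 = ?t1 \<circ> t \<circ> ?t1"
      define s where "s = ?t2 \<circ> t1 \<circ> ?t2"
      have t1: "pairing n t1" unfolding t1_def by (rule pairing_conj[OF t x y(1)])
      have s: "pairing n s" unfolding s_def by (rule pairing_conj[OF t1 x' y(2)])
      have "t1 (n, 1) = (h + 1, 1)" using ne h(1) tx 3 by (simp add: t1_def)
      moreover have "t1 (n, 2) = (x', 2)" using tx' 3 by (simp add: t1_def)
      ultimately have s12: "s (n, 1) = (h + 1, 1)" "s (n, 2) = (h + 1, 2)"
        using ne h(1) by (simp_all add: s_def)
      have "realized 0 n (\<lambda>u. fixed_by n s)"
        by (rule realized_pairing_column_pairs[OF less.IH[OF h(2)], folded h(1)]) (assumption | rule s s12)+
      then have "realized 0 n (\<lambda>u. fixed_by n t1)"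
        unfolding s_def using x' y(2) by (rule realized_pairing_conj)
      then show ?thesis
        unfolding t1_def using x y(1) by (rule realized_pairing_conj)
    qed
  qed
qed

section \<open>Bending columns, and membership of all pair partitions\<close>

lemma realized_cap: "realized (k + k) 0 (\<lambda>u d. agree k u (drop_columns k u))"
proof -
  let ?t = "\<lambda>(x, y). if x \<le> k then (x + k, y) else (x - k, y)"
  have "pairing (k + k) ?t" by (auto simp: pairing_def)
  from realized_involution[OF realized_pairing[OF this]]
  show ?thesis
  proof (rule realized_eq)
    fix u d :: "nat \<times> nat \<Rightarrow> bool"
    show "fixed_by (k + k) ?t u \<longleftrightarrow> agree k u (drop_columns k u)"
    proof
      assume *: "fixed_by (k + k) ?t u"
      show "agree k u (drop_columns k u)"
      proof (rule agreeI)
        fix x y assume "(x, y) \<in> grid k"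
        then show "u (x, y) = drop_columns k u (x, y)"
          using *[unfolded fixed_by_def, THEN bspec, of "(x, y)"] by (auto simp: add.commute)
      qed
    next
      assume *: "agree k u (drop_columns k u)"
      show "fixed_by (k + k) ?t u"
        unfolding fixed_by_def grid_add
      proof (rule ballI)
        fix z assume "z \<in> grid k \<union> (\<lambda>(x, y). (k + x, y)) ` grid k"
        then obtain x y where "(x, y) \<in> grid k" "z = (x, y) \<or> z = (k + x, y)" by auto
        then show "u z = u (?t z)" using agreeD[OF *, of "(x, y)"] by (auto simp: add.commute)
      qed
    qed
  qed
qed

text \<open>Bends the first \<open>k\<close> lower columns to the top.\<close>

lemma realized_rotate:
  assumes S: "realized 0 (k + l) (\<lambda>u. S)"
  shows "realized k l (\<lambda>u d. S (join k u d))"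
proof -
  \<comment> \<open>Next to \<open>S\<close> run \<open>k\<close> through columns on its left; the
    cap joins them to the first \<open>k\<close> columns of \<open>S\<close>, and the remaining
    \<open>l\<close> columns pass down.\<close>
  have lower: "realized k (k + (k + l)) (\<lambda>u d. agree k u d \<and> S (drop_columns k d))"
    using realized_tensor[OF realized_id S] by simp
  have upper: "realized (k + (k + l)) l
      (\<lambda>u d. agree k u (drop_columns k u) \<and> agree l (drop_columns (k + k) u) d)"
    using realized_tensor[OF realized_cap realized_id, of k l] by (simp add: add.assoc)
  have cong: "S d \<longleftrightarrow> S d'" if "agree (k + l) d d'" for d d'
    by (rule realized_cong[OF S agree_refl that])
  show ?thesis
  proof (rule realized_eq[OF realized_compose[OF lower upper]], rule iffI)
    fix u d
    assume "\<exists>m. (agree k u m \<and> S (drop_columns k m)) \<and>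
      agree k m (drop_columns k m) \<and> agree l (drop_columns (k + k) m) d"
    then obtain m where m: "agree k u m" "S (drop_columns k m)"
      "agree k m (drop_columns k m)" "agree l (drop_columns (k + k) m) d" by blast
    have "agree (k + l) (drop_columns k m) (join k u d)"
      unfolding agree_add
    proof (intro conjI agreeI)
      show "drop_columns k m (x, y) = join k u d (x, y)" if "(x, y) \<in> grid k" for x y
        using agreeD[OF m(1) that] agreeD[OF m(3) that] that by (simp add: join_def)
      show "drop_columns k (drop_columns k m) (x, y) = drop_columns k (join k u d) (x, y)"
        if "(x, y) \<in> grid l" for x y
        using agreeD[OF m(4) that] that by (auto simp: join_def)
    qed
    from cong[OF this] m(2) show "S (join k u d)" by simp
  next
    fix u d
    assume *: "S (join k u d)"
    \<comment> \<open>The middle row carries \<open>u\<close> on the through columns,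
      \<open>u\<close> again on the first columns of \<open>S\<close>, and \<open>d\<close> on the
      rest.\<close>
    let ?m = "join k u (join k u d)"
    have "agree (k + l) (drop_columns k ?m) (join k u d)"
      by (rule agreeI) (auto simp: join_def)
    from cong[OF this] * have "S (drop_columns k ?m)" by simp
    moreover have "agree k u ?m" "agree k ?m (drop_columns k ?m)" "agree l (drop_columns (k + k) ?m) d"
      by (rule agreeI, auto simp: join_def)+
    ultimately show "\<exists>m. (agree k u m \<and> S (drop_columns k m)) \<and>
      agree k m (drop_columns k m) \<and> agree l (drop_columns (k + k) m) d" by blast
  qed
qed

lemma unroll_imp_mem:
  assumes p: "p \<in> SP k l" and "realized 0 (k + l) (\<lambda>u. compatible ((`) (unroll k) ` p))"
  shows "p \<in> C"
proof (rule realized_imp_mem[OF _ p])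
  show "realized k l (sem p)"
    by (rule realized_eq[OF realized_rotate[OF assms(2)]]) (simp only: sem_unroll[OF p])
qed

text \<open>Partners are obtained by choice, but disjointness of the blocks forces the choice, which
  is why the resulting map is an involution.\<close>

lemma pair_partition_mem:
  assumes p: "p \<in> SP k l" and card2: "\<forall>B\<in>p. card B = 2"
  shows "p \<in> C"
proof (rule unroll_imp_mem[OF p])
  let ?P = "(`) (unroll k) ` p"
  have p': "partition_on (points k l) p" using p by (simp add: SP_partition)
  have P: "partition_on (grid (k + l)) ?P"
    unfolding unroll_points[symmetric] using p' inj_on_unroll by (rule partition_on_image)
  have card_P: "\<forall>B\<in>?P. card B = 2"
  proof
    fix B assume "B \<in> ?P"
    then obtain B' where B': "B' \<in> p" "B = unroll k ` B'" by blast
    have "B' \<subseteq> points k l" using B' partition_onD1[OF p'] by blast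
    then show "card B = 2" using B' card2 card_image[OF inj_on_subset[OF inj_on_unroll]] by simp
  qed
  have "\<forall>z\<in>grid (k + l). \<exists>z'. {z, z'} \<in> ?P \<and> z \<noteq> z' \<and> z' \<in> grid (k + l)"
    using pair_block_partner[OF P card_P] by (rule ballI)
  then obtain t where t': "\<forall>z\<in>grid (k + l). {z, t z} \<in> ?P \<and> z \<noteq> t z \<and> t z \<in> grid (k + l)"
    by (rule bchoice[THEN exE])
  have t: "{z, t z} \<in> ?P" "z \<noteq> t z" "t z \<in> grid (k + l)"
    if "z \<in> grid (k + l)" for z
    using bspec[OF t' that] by - (elim conjE, assumption)+
  have block: "B = {z, t z}" if "B \<in> ?P" "z \<in> B" for B z
  proof (rule partition_on_unique[OF P that(1) _ that(2)])
    have "z \<in> grid (k + l)" using that partition_onD1[OF P] by blast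
    then show "{z, t z} \<in> ?P" by (rule t)
  qed simp
  have pairing: "pairing (k + l) t"
    unfolding pairing_def
  proof
    fix z assume "z \<in> grid (k + l)"
    note z = t[OF this]
    have "{z, t z} = {t z, t (t z)}" using block[OF z(1), of "t z"] by simp
    then have "t (t z) = z" using z(2) by (auto simp: doubleton_eq_iff)
    then show "t z \<in> grid (k + l) \<and> t z \<noteq> z \<and> t (t z) = z" using z(2,3) by simp
  qed
  have "fixed_by (k + l) t d \<longleftrightarrow> compatible ?P d" for d
  proof
    assume *: "fixed_by (k + l) t d"
    show "compatible ?P d"
    proof (rule compatibleI)
      fix B z z' assume B: "B \<in> ?P" "z \<in> B" "z' \<in> B"
      have "z \<in> grid (k + l)" using B partition_onD1[OF P] by blast
      with * have "d z = d (t z)" unfolding fixed_by_def by (rule bspec)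
      moreover have "z' \<in> {z, t z}" using block[OF B(1,2)] B(3) by (rule subst)
      ultimately show "d z = d z'" by auto
    qed
  next
    assume *: "compatible ?P d"
    show "fixed_by (k + l) t d"
      unfolding fixed_by_def
    proof
      fix z assume "z \<in> grid (k + l)"
      then have "{z, t z} \<in> ?P" by (rule t)
      from compatibleD[OF * this] show "d z = d (t z)" by simp
    qed
  qed
  then show "realized 0 (k + l) (\<lambda>u. compatible ?P)"
    by (rule realized_eq[OF realized_pairing[OF pairing]])
qed

end

section \<open>Merging blocks\<close>

locale merging_category = crossing_category +
  assumes mem_s: "part_s \<in> C" and mem_f1: "part_f 1 \<in> C" and mem_f2: "part_f 2 \<in> C"
begin

lemma realized_s: "realized 0 1 (\<lambda>u d. True)"
  by (rule realizedI[OF mem_s]) (simp_all add: generators_SP[simplified] sem_part_s)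

lemma realized_f: "i \<in> {1, 2} \<Longrightarrow> realized 2 2 (\<lambda>u d. agree 2 u d \<and> d (1, i) = d (2, i))"
  using mem_f1 mem_f2 by (intro realizedI[of "part_f i"] generators_SP sem_part_f) auto

lemma realized_singletons: "realized 0 n (\<lambda>u d. True)"
proof (induction n)
  case 0
  show ?case by (rule realized_empty)
next
  case (Suc n)
  from realized_tensor[OF this realized_s] show ?case by simp
qed

text \<open>The relation of \<open>part_f i\<close> is the identity together with one equation
  between labels, so it is a test for \<open>realized_filter\<close>.\<close>

lemma realized_merge_adjacent:
  assumes "realized k n R" "i \<in> {1, 2}" "1 \<le> x" "x < n"
  shows "realized k n (\<lambda>u d. R u d \<and> d (x, i) = d (Suc x, i))"
proof -
  have n: "n = (x - 1) + 2 + (n - Suc x)" using assms by simp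
  have "realized k ((x - 1) + 2 + (n - Suc x)) R" using assms(1) n by simp
  from realized_filter[OF this realized_f[OF assms(2)], folded n] show ?thesis
    using assms(3) by simp
qed

text \<open>
  The one-block partition of a single through column arises from \<open>a\<close> next to a through column:
  merge the two columns on both levels and cap off the first one with singletons.
\<close>

lemma realized_column: "realized 1 1 (\<lambda>u d. agree 1 u d \<and> d (1, 1) = d (1, 2))"
proof -
  have "realized (0 + 1) (1 + 1) (\<lambda>u d. d (1, 1) = d (1, 2) \<and> agree 1 (drop_columns 0 u) (drop_columns 1 d))"
    by (rule realized_tensor[OF realized_a realized_id])
  then have "realized 1 2 (\<lambda>u d. d (1, 1) = d (1, 2) \<and> agree 1 u (drop_columns 1 d))"
    by (simp add: numeral_2_eq_2)
  \<comment> \<open>Lower column 1 comes from \<open>a\<close>, lower column 2 from the through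
    column; they are merged on level 1, then on level 2.\<close>
  from realized_merge_adjacent[OF realized_merge_adjacent[OF this, of 1 1], of 2 1]
  have A: "realized 1 2 (\<lambda>u d. ((d (1, 1) = d (1, 2) \<and> agree 1 u (drop_columns 1 d)) \<and>
      d (1, 1) = d (Suc 1, 1)) \<and> d (1, 2) = d (Suc 1, 2))" by simp
  have "realized (1 + 1) (0 + 1) (\<lambda>u d. True \<and> agree 1 (drop_columns 1 u) (drop_columns 0 d))"
    by (rule realized_tensor[OF realized_involution[OF realized_s] realized_id])
  then have B: "realized 2 1 (\<lambda>u d. agree 1 (drop_columns 1 u) d)"
    by (simp add: numeral_2_eq_2)
  show ?thesis
  proof (rule realized_eq[OF realized_compose[OF A B]])
    fix u d :: "nat \<times> nat \<Rightarrow> bool"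
    show "(\<exists>m. (((m (1, 1) = m (1, 2) \<and> agree 1 u (drop_columns 1 m)) \<and>
      m (1, 1) = m (Suc 1, 1)) \<and> m (1, 2) = m (Suc 1, 2)) \<and> agree 1 (drop_columns 1 m) d) \<longleftrightarrow>
      agree 1 u d \<and> d (1, 1) = d (1, 2)" (is "?L \<longleftrightarrow> ?R")
    proof
      assume ?L
      then show ?R unfolding agree_1 by (elim exE conjE) simp
    next
      assume ?R
      \<comment> \<open>All labels involved coincide, so the constant labelling fits both middle
        columns.\<close>
      then show ?L unfolding agree_1 by (intro exI[of _ "\<lambda>_. d (1, 1)"]) simp
    qed
  qed
qed

lemma realized_merge_column:
  assumes "realized k n R" "1 \<le> x" "x \<le> n"
  shows "realized k n (\<lambda>u d. R u d \<and> d (x, 1) = d (x, 2))"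
proof -
  have n: "n = (x - 1) + 1 + (n - x)" using assms by simp
  have "realized k ((x - 1) + 1 + (n - x)) R" using assms(1) n by simp
  from realized_filter[OF this realized_column, folded n] show ?thesis
    using assms(2) by simp
qed

text \<open>The point in column \<open>b\<close> is moved next to column \<open>a\<close>, merged
  there and moved back; the transposition fixes \<open>(a, i)\<close>, so the detour changes nothing
  else.\<close>

lemma realized_merge_same_level:
  assumes R: "realized k n R" and i: "i \<in> {1, 2}" and ab: "1 \<le> a" "a < b" "b \<le> n"
  shows "realized k n (\<lambda>u d. R u d \<and> d (a, i) = d (b, i))"
proof -
  let ?t = "transpose (b, i) (Suc a, i)"
  have grid: "(b, i) \<in> grid n" "(Suc a, i) \<in> grid n" using i ab by auto
  have "realized k n (\<lambda>u d. R u (d \<circ> ?t) \<and> d (a, i) = d (Suc a, i))"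
    using ab by (intro realized_merge_adjacent realized_transpose R grid i) auto
  from realized_transpose[OF this grid]
  have "realized k n (\<lambda>u d. R u (d \<circ> ?t \<circ> ?t) \<and> (d \<circ> ?t) (a, i) = (d \<circ> ?t) (Suc a, i))" .
  then show ?thesis using ab by (simp add: comp_assoc)
qed

text \<open>The same detour within level 2: the point on level 2 visits column \<open>a\<close>,
  where the one-block column merges the two levels.\<close>

lemma realized_merge_levels:
  assumes R: "realized k n R" and ab: "(a, 1) \<in> grid n" "(b, 2) \<in> grid n"
  shows "realized k n (\<lambda>u d. R u d \<and> d (a, 1) = d (b, 2))"
proof -
  let ?t = "transpose (b, 2) (a, 2)"
  have grid: "(b, 2) \<in> grid n" "(a, 2) \<in> grid n" using ab by auto
  have "realized k n (\<lambda>u d. R u (d \<circ> ?t) \<and> d (a, 1) = d (a, 2))"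
    using ab by (intro realized_merge_column realized_transpose R grid) auto
  from realized_transpose[OF this grid]
  have "realized k n (\<lambda>u d. R u (d \<circ> ?t \<circ> ?t) \<and> (d \<circ> ?t) (a, 1) = (d \<circ> ?t) (a, 2))" .
  then show ?thesis by (simp add: comp_assoc)
qed

lemma realized_merge:
  assumes R: "realized k n R" and z: "z \<in> grid n" "z' \<in> grid n"
  shows "realized k n (\<lambda>u d. R u d \<and> d z = d z')"
proof -
  obtain a i b j where [simp]: "z = (a, i)" "z' = (b, j)" by fastforce
  have ij: "i \<in> {1, 2}" "j \<in> {1, 2}" and ab: "1 \<le> a" "1 \<le> b" "a \<le> n" "b \<le> n" using z by auto
  consider "i = j" "a < b" | "i = j" "b < a" | "i = j" "a = b" | "i = 1" "j = 2" | "i = 2" "j = 1"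
    using ij by (auto intro: linorder_cases)
  then show ?thesis
  proof cases
    case 1
    with realized_merge_same_level[OF R ij(1) ab(1) _ ab(4)] show ?thesis by simp
  next
    case 2
    with realized_merge_same_level[OF R ij(1) ab(2) _ ab(3)] show ?thesis
      by (auto elim!: realized_eq)
  next
    case 3
    with R show ?thesis by simp
  next
    case 4
    with realized_merge_levels[OF R, of a b] z show ?thesis by simp
  next
    case 5
    with realized_merge_levels[OF R, of b a] z show ?thesis
      by (auto elim!: realized_eq)
  qed
qed

text \<open>Each pair in \<open>E\<close> stands for one equation, imposed by one merge, starting
  from the partition into singletons.\<close>

lemma realized_merges:
  assumes "finite E" "E \<subseteq> grid n \<times> grid n"
  shows "realized 0 n (\<lambda>u d. \<forall>(z, z')\<in>E. d z = d z')"
  using assms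
proof (induction E rule: finite_induct)
  case empty
  show ?case by (rule realized_eq[OF realized_singletons]) simp
next
  case (insert e E)
  obtain z z' where e: "e = (z, z')" by (cases e)
  have "realized 0 n (\<lambda>u d. (\<forall>(z, z')\<in>E. d z = d z') \<and> d z = d z')"
    using insert e by (intro realized_merge) auto
  then show ?case by (rule realized_eq) (auto simp: e)
qed

lemma partition_mem:
  assumes p: "p \<in> SP k l"
  shows "p \<in> C"
proof (rule unroll_imp_mem[OF p])
  let ?P = "(`) (unroll k) ` p"
  have P: "partition_on (grid (k + l)) ?P"
    unfolding unroll_points[symmetric] using p inj_on_unroll
    by (intro partition_on_image) (simp_all add: SP_partition)
  \<comment> \<open>The equations are indexed by the whole same-block relation, which is finite
    because the grid is.\<close>
  let ?E = "{(z, z'). \<exists>B\<in>?P. z \<in> B \<and> z' \<in> B}"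
  have "?E \<subseteq> \<Union>?P \<times> \<Union>?P" by blast
  then have E: "?E \<subseteq> grid (k + l) \<times> grid (k + l)" unfolding partition_onD1[OF P, symmetric] .
  have "finite (grid (k + l) \<times> grid (k + l))" by simp
  then have "finite ?E" using E by (rule rev_finite_subset)
  from realized_merges[OF this E]
  show "realized 0 (k + l) (\<lambda>u. compatible ?P)"
  proof (rule realized_eq)
    fix d
    show "(\<forall>(z, z')\<in>?E. d z = d z') \<longleftrightarrow> compatible ?P d"
    proof
      assume *: "\<forall>(z, z')\<in>?E. d z = d z'"
      show "compatible ?P d"
      proof (rule compatibleI)
        fix B z z' assume "B \<in> ?P" "z \<in> B" "z' \<in> B"
        then have "(z, z') \<in> ?E" by (intro CollectI case_prodI bexI conjI)
        with * have "case (z, z') of (z, z') \<Rightarrow> d z = d z'" by (rule bspec)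
        then show "d z = d z'" by simp
      qed
    next
      assume *: "compatible ?P d"
      show "\<forall>(z, z')\<in>?E. d z = d z'"
      proof
        fix e assume "e \<in> ?E"
        then show "case e of (z, z') \<Rightarrow> d z = d z'"
          by (elim CollectE case_prodE bexE conjE) (simp only: case_prod_conv, rule compatibleD[OF *])
      qed
    qed
  qed
qed

end

section \<open>The generated categories\<close>

lemma generated_category_eqI:
  assumes "is_category P" "S \<subseteq> P" "\<And>C. is_category C \<Longrightarrow> S \<subseteq> C \<Longrightarrow> P \<subseteq> C"
  shows "P = generated_category S"
  unfolding generated_category_def using assms by blast

theorem theorem3:
  shows "spatial_partitions =
           generated_category {part_a, part_c 1, part_c 2, part_f 1, part_f 2, part_s} \<and>
         spatial_pair_partitions =
           generated_category {part_a, part_c 1, part_c 2, part_d 1, part_d 2}"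
proof (intro conjI generated_category_eqI)
  show "is_category spatial_partitions" by (rule is_category_spatial_partitions)
  show "is_category spatial_pair_partitions" by (rule is_category_spatial_pair_partitions)
  have level: "1 \<in> {1, 2::nat}" "2 \<in> {1, 2::nat}" by simp_all
  note SP = generators_SP(3,4) generators_SP(5-7)[OF level(1)] generators_SP(5-7)[OF level(2)]
  show "{part_a, part_c 1, part_c 2, part_f 1, part_f 2, part_s} \<subseteq> spatial_partitions"
    unfolding insert_subset spatial_partitions_iff by (intro conjI empty_subsetI exI) (rule SP)+
  show "{part_a, part_c 1, part_c 2, part_d 1, part_d 2} \<subseteq> spatial_pair_partitions"
    unfolding insert_subset spatial_pair_partitions_iff
    by (intro conjI empty_subsetI exI) (rule SP generators_pairs)+
  fix C assume C: "is_category C"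
  show "spatial_partitions \<subseteq> C"
    if "{part_a, part_c 1, part_c 2, part_f 1, part_f 2, part_s} \<subseteq> C"
  proof -
    interpret merging_category C
      using C that by unfold_locales simp_all
    show ?thesis using partition_mem by (auto simp: spatial_partitions_iff)
  qed
  show "spatial_pair_partitions \<subseteq> C"
    if "{part_a, part_c 1, part_c 2, part_d 1, part_d 2} \<subseteq> C"
  proof -
    interpret crossing_category C
      using C that by unfold_locales simp_all
    show ?thesis using pair_partition_mem by (auto simp: spatial_pair_partitions_iff)
  qed
qed

end
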